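(* Let $N=N_{M,P,\tau}$ be a generalized Nakamura manifold (as defined in the context) which is not a complex torus. Suppose that there exist multi-indices $I,J$ in $\{1,\dots,n\}$ with $I\cap J=\emptyset$ such that $$\tau\cdot c_{IJ}\in 2\pi\mathbb{Z}\setminus\{0\}.$$ Then $N$ admits no geometrically-Bott-Chern-formal Hermitian metrics.
   Context: Generalized Nakamura manifolds. Let $M\in SL(n;\mathbb{Z})$ be diagonalizable over $\mathbb{R}$ with positive eigenvalues $e^{\lambda_1},\dots,e^{\lambda_n}$ ($\lambda_i\in\mathbb{R}$; hence $\sum_i\lambda_i=0$), and let $P\in GL(n;\mathbb{R})$ be such that $PMP^{-1}=\mathrm{diag}(e^{\lambda_1},\dots,e^{\lambda_n})$. Let $\rho:\mathbb{C}\to GL(n;\mathbb{C})$, $\rho(w)=\mathrm{diag}(e^{\frac12\lambda_1(w+\bar w)},\dots,e^{\frac12\lambda_n(w+\bar w)})$, and let $\mathbb{C}\ltimes_\rho\mathbb{C}^n$ be the corresponding semidirect product, with coordinates $(w,z_1,\dots,z_n)$. For $\tau\in\mathbb{R}\setminus\{0\}$ put $\Gamma'_\tau=\mathbb{Z}\oplus\sqrt{-1}\,\tau\mathbb{Z}$, $\Gamma''_P=P\mathbb{Z}^n\oplus\sqrt{-1}P\mathbb{Z}^n$ and $\Gamma_{P,\tau}=\Gamma'_\tau\ltimes_\rho\Gamma''_P$, a discrete subgroup. Then $N_{M,P,\tau}=\Gamma_{P,\tau}\backslash(\mathbb{C}\ltimes_\rho\mathbb{C}^n)$ is a compact complex solvmanifold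 of complex dimension $n+1$. That $N_{M,P,\tau}$ is not a complex torus means that $\lambda_i\neq0$ for some $i$. Notation. Multi-indices are strictly increasing tuples $I=(i_1<\dots<i_p)$, $J=(j_1<\dots<j_q)$ of elements of $\{1,\dots,n\}$, also regarded as subsets of $\{1,\dots,n\}$, and $c_{IJ}=\sum_{\sigma=1}^p\lambda_{i_\sigma}+\sum_{\sigma=1}^q\lambda_{j_\sigma}$. Geometrically-Bott-Chern-formal metrics. On a compact complex manifold $X$ of complex dimension $m$ with Hermitian metric $g$, let $*:\mathcal{A}^{p,q}(X)\to\mathcal{A}^{m-p,m-q}(X)$ be the $\mathbb{C}$-antilinear Hodge star operator. A $(p,q)$-form $\alpha$ is Bott--Chern harmonic if $\partial\alpha=0$, $\bar\partial\alpha=0$ and $\partial\bar\partial{*}\alpha=0$. The metric $g$ is geometrically-Bott-Chern-formal if the space of Bott--Chern harmonic forms (direct sum over all bidegrees) is closed under the wedge product. *)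

theory Defs
  imports "HOL-Analysis.Analysis" "HOL-Library.Option_ord"
begin

section \<open>Differential forms on complex Euclidean space\<close>

text \<open>
  All manifolds considered are quotients of \<open>\<complex>\<^sup>m\<close> by a group of biholomorphisms acting freely
  and properly discontinuously.  Tensors on such a quotient are the tensors on \<open>\<complex>\<^sup>m\<close> that are
  invariant under pull-back by the group.  The coordinates \<open>z\<^sub>k\<close> of \<open>\<complex>\<^sup>m\<close> are indexed by a finite
  linearly ordered type.
\<close>

type_synonym 'i cspace = "complex ^ 'i"
type_synonym 'i cmat = "complex ^ 'i ^ 'i"

datatype 'i gen = Dz 'i | Dzb 'i

instance gen :: (finite) finite
proof
  have "(UNIV :: 'a gen set) = range Dz \<union> range Dzb"
    by (metis UNIV_eq_I UnCI gen.exhaust rangeI)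
  then show "finite (UNIV :: 'a gen set)"
    by (metis finite_UnI finite_class.finite_UNIV finite_imageI)
qed

text \<open>All \<open>dz\<^sub>k\<close> precede all \<open>d\<zbar>\<^sub>k\<close>.\<close>

instantiation gen :: (linorder) linorder
begin

definition less_eq_gen :: "'a gen \<Rightarrow> 'a gen \<Rightarrow> bool" where
  "less_eq_gen a b = (case a of
     Dz i \<Rightarrow> (case b of Dz j \<Rightarrow> i \<le> j | Dzb j \<Rightarrow> True)
   | Dzb i \<Rightarrow> (case b of Dz j \<Rightarrow> False | Dzb j \<Rightarrow> i \<le> j))"

definition less_gen :: "'a gen \<Rightarrow> 'a gen \<Rightarrow> bool" where
  "less_gen a b \<longleftrightarrow> a \<le> b \<and> \<not> b \<le> a"

instance
  by standard (auto simp: less_eq_gen_def less_gen_def split: gen.splits)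

end

text \<open>
  For a set \<open>S\<close> of generators let \<open>e\<^sub>S\<close> be the wedge product of its elements in increasing order,
  so that \<open>e\<^sub>S = dz\<^sub>A \<and> d\<zbar>\<^sub>B\<close> with \<open>A = Dz -` S\<close> and \<open>B = Dzb -` S\<close>.  An inhomogeneous
  differential form \<open>\<alpha> = \<Sum>\<^sub>S \<alpha>\<^sub>S e\<^sub>S\<close> is given by its coefficient functions, \<open>\<alpha> x S = \<alpha>\<^sub>S(x)\<close>.
\<close>

type_synonym 'i form = "'i cspace \<Rightarrow> 'i gen set \<Rightarrow> complex"

text \<open>\<open>e\<^sub>S \<and> e\<^sub>T = shuffle_sign S T \<cdot> e\<^bsub>S \<union> T\<^esub>\<close> for disjoint \<open>S\<close>, \<open>T\<close>.\<close>

definition shuffle_sign :: "'a::linorder set \<Rightarrow> 'a set \<Rightarrow> complex" where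
  "shuffle_sign S T = (- 1) ^ card {(s, t). s \<in> S \<and> t \<in> T \<and> t < s}"

definition wedge :: "('i::{finite,linorder}) form \<Rightarrow> 'i form \<Rightarrow> 'i form" where
  "wedge \<alpha> \<beta> = (\<lambda>x U. \<Sum>S\<in>Pow U. shuffle_sign S (U - S) * \<alpha> x S * \<beta> x (U - S))"

definition gen_form :: "('i::{finite,linorder}) gen \<Rightarrow> 'i form" where
  "gen_form e = (\<lambda>x S. if S = {e} then 1 else 0)"

definition dir_deriv :: "'i::finite cspace \<Rightarrow> ('i cspace \<Rightarrow> complex) \<Rightarrow> ('i cspace \<Rightarrow> complex)"
  where "dir_deriv v f = (\<lambda>x. frechet_derivative f (at x) v)"

text \<open>\<open>C\<^sup>\<infinity>\<close> in the real sense: all iterated directional derivatives exist and are differentiable.\<close>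

definition smooth :: "('i::finite cspace \<Rightarrow> complex) \<Rightarrow> bool" where
  "smooth f \<longleftrightarrow> (\<forall>vs x. foldr dir_deriv vs f differentiable (at x))"

definition smooth_form :: "('i::{finite,linorder}) form \<Rightarrow> bool" where
  "smooth_form \<alpha> \<longleftrightarrow> (\<forall>S. smooth (\<lambda>x. \<alpha> x S))"

text \<open>The Wirtinger derivatives \<open>\<partial>/\<partial>z\<^sub>k\<close> and \<open>\<partial>/\<partial>\<zbar>\<^sub>k\<close>.\<close>

fun wirtinger :: "'i gen \<Rightarrow> ('i::finite cspace \<Rightarrow> complex) \<Rightarrow> ('i cspace \<Rightarrow> complex)" where
  "wirtinger (Dz k) f = (\<lambda>x. (dir_deriv (axis k 1) f x - \<i> * dir_deriv (axis k \<i>) f x) / 2)"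
| "wirtinger (Dzb k) f = (\<lambda>x. (dir_deriv (axis k 1) f x + \<i> * dir_deriv (axis k \<i>) f x) / 2)"

definition coeff_deriv :: "('i::{finite,linorder}) gen \<Rightarrow> 'i form \<Rightarrow> 'i form" where
  "coeff_deriv e \<alpha> = (\<lambda>x S. wirtinger e (\<lambda>y. \<alpha> y S) x)"

definition del :: "('i::{finite,linorder}) form \<Rightarrow> 'i form" where
  "del \<alpha> = (\<lambda>x U. \<Sum>k\<in>UNIV. wedge (gen_form (Dz k)) (coeff_deriv (Dz k) \<alpha>) x U)"

definition delbar :: "('i::{finite,linorder}) form \<Rightarrow> 'i form" where
  "delbar \<alpha> = (\<lambda>x U. \<Sum>k\<in>UNIV. wedge (gen_form (Dzb k)) (coeff_deriv (Dzb k) \<alpha>) x U)"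

definition has_bidegree :: "nat \<Rightarrow> nat \<Rightarrow> ('i::{finite,linorder}) form \<Rightarrow> bool" where
  "has_bidegree p q \<alpha> \<longleftrightarrow>
     (\<forall>x S. \<alpha> x S \<noteq> 0 \<longrightarrow> card (Dz -` S) = p \<and> card (Dzb -` S) = q)"

text \<open>
  The determinant of the submatrix of \<open>a\<close> with rows \<open>S\<close> and columns \<open>T\<close> in increasing order:
  if \<open>s \<mapsto> \<Sum>\<^sub>t a s t \<cdot> e\<^sub>t\<close> is a linear map on generators, the induced map on the exterior
  algebra sends \<open>e\<^sub>S\<close> to \<open>\<Sum>\<^sub>T minor a S T \<cdot> e\<^sub>T\<close>.
\<close>

definition minor :: "('a::{finite,linorder} \<Rightarrow> 'a \<Rightarrow> complex) \<Rightarrow> 'a set \<Rightarrow> 'a set \<Rightarrow> complex" where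
  "minor a S T = (if card S = card T then
     (\<Sum>\<sigma> | \<sigma> permutes {..<card S}. of_int (sign \<sigma>) *
        (\<Prod>r<card S. a (sorted_list_of_set S ! r) (sorted_list_of_set T ! \<sigma> r)))
     else 0)"

fun coord :: "'i::finite gen \<Rightarrow> 'i cspace \<Rightarrow> complex" where
  "coord (Dz k) x = x $ k"
| "coord (Dzb k) x = cnj (x $ k)"

text \<open>\<open>F\<^sup>* e\<^sub>s = \<Sum>\<^sub>t jacobian F x s t \<cdot> e\<^sub>t\<close> at \<open>x\<close>.\<close>

definition jacobian ::
    "('i cspace \<Rightarrow> 'i cspace) \<Rightarrow> 'i cspace \<Rightarrow> 'i::finite gen \<Rightarrow> 'i gen \<Rightarrow> complex" where
  "jacobian F x s t = wirtinger t (\<lambda>y. coord s (F y)) x"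

definition pullback ::
    "('i cspace \<Rightarrow> 'i cspace) \<Rightarrow> ('i::{finite,linorder}) form \<Rightarrow> 'i form" where
  "pullback F \<alpha> = (\<lambda>x T. \<Sum>S\<in>UNIV. \<alpha> (F x) S * minor (jacobian F x) S T)"

text \<open>Differential forms on the quotient of \<open>\<complex>\<^sup>m\<close> by the group \<open>D\<close> of deck transformations.\<close>

definition quotient_form ::
    "('i cspace \<Rightarrow> 'i cspace) set \<Rightarrow> ('i::{finite,linorder}) form \<Rightarrow> bool" where
  "quotient_form D \<alpha> \<longleftrightarrow> smooth_form \<alpha> \<and> (\<forall>F\<in>D. pullback F \<alpha> = \<alpha>)"


section \<open>Hermitian metrics and the Hodge star\<close>

text \<open>
  A Hermitian metric is given by the matrix \<open>h\<close> of the Hermitian form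
  \<open>\<Sum>\<^bsub>k l\<^esub> h\<^bsub>k l\<^esub> dz\<^sub>k \<otimes> d\<zbar>\<^sub>l\<close>, whose real part is the Riemannian metric \<open>g\<close>.  The invariance
  condition is \<open>F\<^sup>* h = h\<close> for the holomorphic maps \<open>F \<in> D\<close>.
\<close>

definition hermitian_metric ::
    "('i cspace \<Rightarrow> 'i cspace) set \<Rightarrow> ('i cspace \<Rightarrow> 'i::finite cmat) \<Rightarrow> bool" where
  "hermitian_metric D h \<longleftrightarrow>
     (\<forall>k l. smooth (\<lambda>x. h x $ k $ l)) \<and>
     (\<forall>x k l. h x $ l $ k = cnj (h x $ k $ l)) \<and>
     (\<forall>x v. v \<noteq> 0 \<longrightarrow> 0 < Re (\<Sum>k\<in>UNIV. \<Sum>l\<in>UNIV. v $ k * h x $ k $ l * cnj (v $ l))) \<and>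
     (\<forall>F\<in>D. \<forall>x k l. h x $ k $ l =
        (\<Sum>a\<in>UNIV. \<Sum>b\<in>UNIV. jacobian F x (Dz a) (Dz k) * h (F x) $ a $ b
                               * cnj (jacobian F x (Dz b) (Dz l))))"

text \<open>
  The sesquilinear extension of \<open>g = Re h\<close> to complexified tangent vectors satisfies
  \<open>\<langle>\<partial>\<^sub>k, \<partial>\<^sub>l\<rangle> = h\<^bsub>k l\<^esub> / 2\<close>; the dual basis therefore has the Gram matrix below.
\<close>

fun covector_inner :: "'i cmat \<Rightarrow> 'i::finite gen \<Rightarrow> 'i gen \<Rightarrow> complex" where
  "covector_inner H (Dz k) (Dz l) = 2 * matrix_inv H $ l $ k"
| "covector_inner H (Dzb k) (Dzb l) = 2 * matrix_inv H $ k $ l"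
| "covector_inner H (Dz k) (Dzb l) = 0"
| "covector_inner H (Dzb k) (Dz l) = 0"

text \<open>The induced inner product on the exterior algebra, \<open>\<langle>e\<^sub>S, e\<^sub>T\<rangle> = det (\<langle>s, t\<rangle>)\<^bsub>s \<in> S, t \<in> T\<^esub>\<close>.\<close>

definition form_inner ::
    "'i cmat \<Rightarrow> ('i::{finite,linorder} gen set \<Rightarrow> complex) \<Rightarrow> ('i gen set \<Rightarrow> complex) \<Rightarrow> complex"
  where "form_inner H a b =
     (\<Sum>S\<in>UNIV. \<Sum>T\<in>UNIV. a S * cnj (b T) * minor (covector_inner H) S T)"

text \<open>
  The Riemannian volume form is \<open>det h \<cdot> (\<i>/2)\<^sup>m dz\<^sub>1 \<and> d\<zbar>\<^sub>1 \<and> \<dots> \<and> dz\<^sub>m \<and> d\<zbar>\<^sub>m\<close>; the sign comes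
  from moving all \<open>dz\<^sub>k\<close> to the front.
\<close>

definition vol_coeff :: "'i::finite cmat \<Rightarrow> complex" where
  "vol_coeff H = (\<i> / 2) ^ CARD('i) * (- 1) ^ (CARD('i) * (CARD('i) - 1) div 2) * det H"

text \<open>
  The antilinear Hodge star, characterised by \<open>\<alpha> \<and> *\<beta> = \<langle>\<alpha>, \<beta>\<rangle> vol\<close>; see
  \<open>wedge_hodge_star\<close> and \<open>hodge_star_unique\<close> below.
\<close>

definition hodge_star :: "('i cspace \<Rightarrow> 'i cmat) \<Rightarrow> ('i::{finite,linorder}) form \<Rightarrow> 'i form" where
  "hodge_star h \<beta> = (\<lambda>x T. shuffle_sign (- T) T * vol_coeff (h x) *
     (\<Sum>S\<in>UNIV. cnj (\<beta> x S) * minor (covector_inner (h x)) (- T) S))"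

lemma shuffle_sign_square: "shuffle_sign S T * shuffle_sign S T = 1"
  by (simp add: shuffle_sign_def flip: power_add mult_2)

lemma wedge_hodge_star:
  "wedge \<alpha> (hodge_star h \<beta>) x UNIV = form_inner (h x) (\<alpha> x) (\<beta> x) * vol_coeff (h x)"
proof -
  have "wedge \<alpha> (hodge_star h \<beta>) x UNIV =
    (\<Sum>S\<in>UNIV. (shuffle_sign S (- S) * shuffle_sign S (- S)) * (\<alpha> x S * vol_coeff (h x) *
      (\<Sum>T\<in>UNIV. cnj (\<beta> x T) * minor (covector_inner (h x)) S T)))"
    unfolding wedge_def hodge_star_def by (simp add: Compl_eq_Diff_UNIV double_diff mult_ac)
  also have "\<dots> = form_inner (h x) (\<alpha> x) (\<beta> x) * vol_coeff (h x)"
    by (simp add: shuffle_sign_square form_inner_def sum_distrib_left sum_distrib_right mult_ac)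
  finally show ?thesis .
qed

lemma hodge_star_unique:
  assumes "\<And>\<alpha> x. wedge \<alpha> \<eta> x UNIV = form_inner (h x) (\<alpha> x) (\<beta> x) * vol_coeff (h x)"
  shows "\<eta> = hodge_star h \<beta>"
proof (intro ext)
  fix x T
  define \<alpha> where "\<alpha> = (\<lambda>(y :: 'a cspace) (S :: 'a gen set). if S = - T then 1 else 0 :: complex)"
  have top: "wedge \<alpha> \<theta> x UNIV = shuffle_sign (- T) T * \<theta> x T" for \<theta>
  proof -
    have "wedge \<alpha> \<theta> x UNIV =
      (\<Sum>S\<in>UNIV. if S = - T then shuffle_sign (- T) T * \<theta> x T else 0)"
      unfolding wedge_def \<alpha>_def by (intro sum.cong) (auto simp: Diff_eq)
    then show ?thesis by simp
  qed
  have "shuffle_sign (- T) T * \<eta> x T = shuffle_sign (- T) T * hodge_star h \<beta> x T"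
    using assms[of \<alpha> x] wedge_hodge_star[of \<alpha> h \<beta> x] top by simp
  then show "\<eta> x T = hodge_star h \<beta> x T"
    using shuffle_sign_square[of "- T" T] by auto
qed


section \<open>Geometrically-Bott-Chern-formal metrics\<close>

definition bc_harmonic ::
    "('i cspace \<Rightarrow> 'i cspace) set \<Rightarrow> ('i cspace \<Rightarrow> 'i cmat) \<Rightarrow> nat \<Rightarrow> nat \<Rightarrow>
     ('i::{finite,linorder}) form \<Rightarrow> bool" where
  "bc_harmonic D h p q \<alpha> \<longleftrightarrow> quotient_form D \<alpha> \<and> has_bidegree p q \<alpha> \<and>
     del \<alpha> = (\<lambda>x S. 0) \<and> delbar \<alpha> = (\<lambda>x S. 0) \<and>
     del (delbar (hodge_star h \<alpha>)) = (\<lambda>x S. 0)"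

text \<open>The direct sum over all bidegrees.\<close>

definition bc_harmonic_space ::
    "('i cspace \<Rightarrow> 'i cspace) set \<Rightarrow> ('i cspace \<Rightarrow> 'i cmat) \<Rightarrow>
     ('i::{finite,linorder}) form set" where
  "bc_harmonic_space D h = {\<lambda>x S. \<Sum>p\<le>CARD('i). \<Sum>q\<le>CARD('i). \<alpha> p q x S | \<alpha>.
     \<forall>p q. bc_harmonic D h p q (\<alpha> p q)}"

definition geom_bc_formal ::
    "('i cspace \<Rightarrow> 'i cspace) set \<Rightarrow>
     ('i cspace \<Rightarrow> 'i::{finite,linorder} cmat) \<Rightarrow> bool" where
  "geom_bc_formal D h \<longleftrightarrow>
     (\<forall>\<alpha>\<in>bc_harmonic_space D h. \<forall>\<beta>\<in>bc_harmonic_space D h. wedge \<alpha> \<beta> \<in> bc_harmonic_space D h)"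


section \<open>Generalized Nakamura manifolds\<close>

text \<open>
  The underlying manifold of the semidirect product of \<open>\<complex>\<close> and \<open>\<complex>\<^sup>n\<close> is \<open>\<complex>\<^bsup>n+1\<^esup>\<close> with coordinates
  indexed by \<open>'n option\<close>: \<open>w\<close> has index \<open>None\<close> and \<open>z\<^sub>i\<close> has index \<open>Some i\<close>.
\<close>

definition point :: "complex \<Rightarrow> complex ^ 'n \<Rightarrow> complex ^ 'n::finite option" where
  "point w z = (\<chi> k. case k of None \<Rightarrow> w | Some i \<Rightarrow> z $ i)"

definition w_part :: "complex ^ 'n::finite option \<Rightarrow> complex" where
  "w_part x = x $ None"

definition z_part :: "complex ^ 'n::finite option \<Rightarrow> complex ^ 'n" where
  "z_part x = (\<chi> i. x $ Some i)"

definition rho :: "('n::finite \<Rightarrow> real) \<Rightarrow> complex \<Rightarrow> complex ^ 'n ^ 'n" where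
  "rho lam w = (\<chi> i j. if i = j then exp (1 / 2 * of_real (lam i) * (w + cnj w)) else 0)"

definition nak_mult ::
    "('n::finite \<Rightarrow> real) \<Rightarrow> complex ^ 'n option \<Rightarrow> complex ^ 'n option \<Rightarrow> complex ^ 'n option" where
  "nak_mult lam g x = point (w_part g + w_part x) (z_part g + rho lam (w_part g) *v z_part x)"

definition lattice1 :: "real \<Rightarrow> complex set" where
  "lattice1 \<tau> = {of_int a + \<i> * of_real \<tau> * of_int b | a b :: int. True}"

definition lattice2 :: "real ^ 'n ^ 'n::finite \<Rightarrow> (complex ^ 'n) set" where
  "lattice2 P = {map_matrix of_real P *v ((\<chi> i. of_int (u $ i)) + (\<chi> i. \<i> * of_int (v $ i)))
                 | u v :: int ^ 'n. True}"

definition nak_lattice :: "real ^ 'n ^ 'n::finite \<Rightarrow> real \<Rightarrow> (complex ^ 'n option) set" where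
  "nak_lattice P \<tau> = {point a b | a b. a \<in> lattice1 \<tau> \<and> b \<in> lattice2 P}"

text \<open>
  The left translations by the lattice; the generalized Nakamura manifold is the quotient of
  \<open>\<complex>\<^bsup>n+1\<^esup>\<close> by these.
\<close>

definition nak_deck ::
    "real ^ 'n ^ 'n::finite \<Rightarrow> ('n \<Rightarrow> real) \<Rightarrow> real \<Rightarrow>
     (complex ^ 'n option \<Rightarrow> complex ^ 'n option) set" where
  "nak_deck P lam \<tau> = nak_mult lam ` nak_lattice P \<tau>"

text \<open>
  The eigenvalues of \<open>M\<close> are \<open>exp (lam i)\<close>; in particular they are positive and \<open>M\<close> is
  diagonalizable over \<open>\<real>\<close>.
\<close>

definition nakamura_data ::
    "int ^ 'n ^ 'n::finite \<Rightarrow> real ^ 'n ^ 'n \<Rightarrow> ('n \<Rightarrow> real) \<Rightarrow> real \<Rightarrow> bool" where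
  "nakamura_data M P lam \<tau> \<longleftrightarrow> det M = 1 \<and> invertible P \<and>
     P ** map_matrix real_of_int M ** matrix_inv P = (\<chi> i j. if i = j then exp (lam i) else 0) \<and>
     \<tau> \<noteq> 0"

definition c_sum :: "('n \<Rightarrow> real) \<Rightarrow> 'n set \<Rightarrow> 'n set \<Rightarrow> real" where
  "c_sum lam I J = (\<Sum>i\<in>I. lam i) + (\<Sum>j\<in>J. lam j)"

end

theory Submission
  imports Defs
begin

text \<open>
  Put \<open>K = I \<union> J\<close> and \<open>c = \<Sum>\<^bsub>i \<in> K\<^esub> \<lambda>\<^sub>i\<close>; as \<open>I\<close> and \<open>J\<close> are disjoint, \<open>c\<close> is the number \<open>c\<^bsub>IJ\<^esub>\<close>.
  The form \<open>\<alpha> = e\<^bsup>-cw\<^esup> dw \<and> dz\<^sub>K\<close> is holomorphic and closed.  Translation by a lattice point over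
  \<open>a \<in> \<Gamma>'\<^sub>\<tau>\<close> multiplies it by \<open>exp (-\<i> c Im a)\<close>, which is \<open>1\<close> because \<open>\<tau> c \<in> 2\<pi>\<int>\<close>; so \<open>\<alpha>\<close> lives on
  \<open>N\<close>.  A closed form of type \<open>(p, 0)\<close> or \<open>(0, p)\<close> is Bott--Chern harmonic for every Hermitian metric:
  its star already contains all \<open>d\<zbar>\<^sub>k\<close>, respectively all \<open>dz\<^sub>k\<close>, so \<open>del delbar\<close> kills the star
  for reasons of degree (\<open>bc_harmonic_character\<close>).

  If the metric were geometrically-Bott-Chern-formal, then \<open>\<eta> = \<alpha> \<and> \<beta>\<close>, with \<open>\<beta>\<close> the complex conjugate
  of \<open>\<alpha>\<close>, would be harmonic too, so \<open>\<omega> = *\<eta>\<close> would satisfy \<open>del delbar \<omega> = 0\<close>.  On the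
  other hand \<open>\<eta>\<close> is up to a constant \<open>del delbar (e\<^bsup>-2c Re w\<^esup> dz\<^sub>K \<and> d\<zbar>\<^sub>K)\<close>, and a harmonic form in
  the image of \<open>del delbar\<close> on a compact manifold vanishes.  Instead of integrating over \<open>N\<close>, the
  proof extracts this contradiction from one coefficient of \<open>\<omega>\<close>, the one complementary to \<open>\<eta>\<close>.

  Up to a constant factor, that coefficient is
  \<open>g = det h \<cdot> e\<^bsup>-2c Re w\<^esup> \<cdot> (principal minor of the dual metric)\<close>.
  It is positive (\<open>posdef_hermitian_det_pos\<close>, \<open>covector_minor_pos\<close>), and the translation
  \<open>w \<mapsto> w + k\<close> multiplies it by \<open>e\<^bsup>2ck\<^esup>\<close>, where \<open>\<Sum> \<lambda>\<^sub>i = 0\<close> enters through \<open>det h\<close>.  All coefficients of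
  \<open>\<omega>\<close> are periodic along the fibres \<open>Re w = const\<close>, which the lattice makes compact.  Averaging
  \<open>del delbar \<omega> = 0\<close> over these fibres removes every derivative except those in \<open>Re w\<close>
  (\<open>averaged_second_derivative\<close>), so the average \<open>f\<close> of \<open>g\<close> has vanishing second derivative in \<open>Re w\<close>: it
  is affine along that line.  By compactness of the fibre \<open>\<bar>f\<bar> \<le> C e\<^bsup>2ck\<^esup>\<close> at \<open>Re w = k\<close> for every integer
  \<open>k\<close>.  As \<open>c \<noteq> 0\<close>, an affine function with this decay in one direction is \<open>0\<close>, whereas \<open>f > 0\<close>.
\<close>

section \<open>Calculus of smooth functions\<close>

lemma has_derivative_dir_deriv:
  fixes f :: "'i::finite cspace \<Rightarrow> complex"
  assumes "f differentiable (at x)"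
  shows "(f has_derivative (\<lambda>v. dir_deriv v f x)) (at x)"
  using assms unfolding dir_deriv_def by (simp add: frechet_derivative_works)

lemma dir_deriv_eqI:
  assumes "(f has_derivative f') (at x)"
  shows "dir_deriv v f x = f' v"
  using frechet_derivative_at[OF assms] by (simp add: dir_deriv_def)

lemma dir_deriv_const [simp]: "dir_deriv v (\<lambda>x. c) = (\<lambda>x. 0)"
  by (intro ext dir_deriv_eqI[where f' = "\<lambda>_. 0"]) auto

lemma dir_deriv_add:
  assumes "f differentiable (at x)" "g differentiable (at x)"
  shows "dir_deriv v (\<lambda>x. f x + g x) x = dir_deriv v f x + dir_deriv v g x"
  using assms by (intro dir_deriv_eqI[OF has_derivative_add] has_derivative_dir_deriv)

lemma dir_deriv_mult:
  assumes "f differentiable (at x)" "g differentiable (at x)"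
  shows "dir_deriv v (\<lambda>x. f x * g x) x = f x * dir_deriv v g x + dir_deriv v f x * g x"
  using assms by (intro dir_deriv_eqI[OF has_derivative_mult] has_derivative_dir_deriv)

lemma dir_deriv_inverse:
  assumes "f differentiable (at x)" "f x \<noteq> 0"
  shows "dir_deriv v (\<lambda>x. inverse (f x)) x = - (inverse (f x) * dir_deriv v f x * inverse (f x))"
  using assms by (intro dir_deriv_eqI[OF Deriv.has_derivative_inverse] has_derivative_dir_deriv)

lemma dir_deriv_bounded_linear:
  assumes "bounded_linear L" "f differentiable (at x)"
  shows "dir_deriv v (\<lambda>x. L (f x)) x = L (dir_deriv v f x)"
  using assms by (intro dir_deriv_eqI[OF bounded_linear.has_derivative] has_derivative_dir_deriv)

text \<open>
  Iterated derivatives of a product are sums of products.  Closure of smoothness under the algebraic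
  operations is therefore proved by induction on the number of derivatives, with the function kept
  arbitrary; this predicate peels off the innermost derivative, where the product and quotient rules apply.
\<close>

primrec smooth_upto :: "nat \<Rightarrow> ('i::finite cspace \<Rightarrow> complex) \<Rightarrow> bool" where
  "smooth_upto 0 f \<longleftrightarrow> (\<forall>x. f differentiable (at x))"
| "smooth_upto (Suc n) f \<longleftrightarrow> (\<forall>x. f differentiable (at x)) \<and> (\<forall>v. smooth_upto n (dir_deriv v f))"

lemma smooth_upto_differentiable: "smooth_upto n f \<Longrightarrow> f differentiable (at x)"
  by (cases n) auto

lemma smooth_upto_Suc_D: "smooth_upto (Suc n) f \<Longrightarrow> smooth_upto n f"
  by (induction n arbitrary: f) auto

lemma smooth_upto_iff:
  "smooth_upto n f \<longleftrightarrow> (\<forall>vs x. length vs \<le> n \<longrightarrow> foldr dir_deriv vs f differentiable (at x))"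
proof (induction n arbitrary: f)
  case (Suc n)
  have "(\<forall>vs x. length vs \<le> Suc n \<longrightarrow> foldr dir_deriv vs f differentiable (at x)) \<longleftrightarrow>
    (\<forall>x. f differentiable (at x)) \<and>
    (\<forall>v vs x. length vs \<le> n \<longrightarrow> foldr dir_deriv vs (dir_deriv v f) differentiable (at x))"
    (is "?L \<longleftrightarrow> ?R")
  proof
    assume L: ?L
    show ?R
    proof (intro conjI allI impI)
      show "f differentiable (at x)" for x using L[rule_format, of "[]"] by simp
      show "foldr dir_deriv vs (dir_deriv v f) differentiable (at x)" if "length vs \<le> n" for v vs x
        using L[rule_format, of "vs @ [v]"] that by simp
    qed
  next
    assume R: ?R
    show ?L
    proof (intro allI impI)
      fix vs :: "'a cspace list" and x assume "length vs \<le> Suc n"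
      then show "foldr dir_deriv vs f differentiable (at x)"
        using R by (cases vs rule: rev_cases) auto
    qed
  qed
  then show ?case using Suc by simp
qed auto

lemma smooth_iff_smooth_upto: "smooth f \<longleftrightarrow> (\<forall>n. smooth_upto n f)"
  by (auto simp: smooth_def smooth_upto_iff)

lemma smooth_differentiable: "smooth f \<Longrightarrow> f differentiable (at x)"
  using smooth_iff_smooth_upto smooth_upto_differentiable by blast

lemma smooth_dir_deriv: "smooth f \<Longrightarrow> smooth (dir_deriv v f)"
  unfolding smooth_iff_smooth_upto by (metis smooth_upto.simps(2))

lemma smooth_continuous_on: "smooth f \<Longrightarrow> continuous_on S f"
  by (meson continuous_at_imp_continuous_on differentiable_imp_continuous_within smooth_differentiable)

lemma dir_deriv_mult_left:
  "smooth f \<Longrightarrow> dir_deriv v (\<lambda>x. c * f x) = (\<lambda>x. c * dir_deriv v f x)"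
  using dir_deriv_mult[of "\<lambda>y. c" _ f v] smooth_differentiable by (auto simp: fun_eq_iff)

lemma smooth_upto_const [simp]: "smooth_upto n (\<lambda>x. c)"
  by (induction n arbitrary: c) auto

lemma smooth_upto_add:
  "smooth_upto n f \<Longrightarrow> smooth_upto n g \<Longrightarrow> smooth_upto n (\<lambda>x. f x + g x)"
proof (induction n arbitrary: f g)
  case (Suc n)
  then have "dir_deriv v (\<lambda>x. f x + g x) = (\<lambda>x. dir_deriv v f x + dir_deriv v g x)" for v
    by (intro ext dir_deriv_add) auto
  with Suc show ?case by auto
qed auto

lemma smooth_upto_mult:
  "smooth_upto n f \<Longrightarrow> smooth_upto n g \<Longrightarrow> smooth_upto n (\<lambda>x. f x * g x)"
proof (induction n arbitrary: f g)
  case (Suc n)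
  then have "dir_deriv v (\<lambda>x. f x * g x) = (\<lambda>x. f x * dir_deriv v g x + dir_deriv v f x * g x)" for v
    by (intro ext dir_deriv_mult) auto
  moreover have "smooth_upto n (\<lambda>x. f x * dir_deriv v g x + dir_deriv v f x * g x)" for v
    using Suc smooth_upto_Suc_D by (intro smooth_upto_add Suc.IH) (simp_all, blast+)
  ultimately show ?case using Suc by auto
qed auto

lemma smooth_upto_inverse:
  "smooth_upto n f \<Longrightarrow> \<forall>x. f x \<noteq> 0 \<Longrightarrow> smooth_upto n (\<lambda>x. inverse (f x))"
proof (induction n arbitrary: f)
  case (Suc n)
  then have "dir_deriv v (\<lambda>x. inverse (f x)) =
      (\<lambda>x. (- 1) * (inverse (f x) * dir_deriv v f x * inverse (f x)))" for v
    by (auto simp: dir_deriv_inverse)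
  moreover have "smooth_upto n (\<lambda>x. (- 1) * (inverse (f x) * dir_deriv v f x * inverse (f x)))" for v
    using Suc smooth_upto_Suc_D[OF Suc.prems(1)] by (intro smooth_upto_mult Suc.IH smooth_upto_const) auto
  ultimately show ?case using Suc by auto
qed auto

lemma smooth_upto_bounded_linear:
  assumes "bounded_linear L"
  shows "smooth_upto n f \<Longrightarrow> smooth_upto n (\<lambda>x. L (f x))"
proof (induction n arbitrary: f)
  case 0
  then show ?case
    using bounded_linear.has_derivative[OF assms] by (auto simp: differentiable_def) blast
next
  case (Suc n)
  then have "dir_deriv v (\<lambda>x. L (f x)) = (\<lambda>x. L (dir_deriv v f x))" for v
    by (auto simp: dir_deriv_bounded_linear[OF assms])
  with Suc show ?case
    using bounded_linear.has_derivative[OF assms] by (auto simp: differentiable_def) blast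
qed

lemma smooth_const [simp]: "smooth (\<lambda>x. c)"
  by (simp add: smooth_iff_smooth_upto)

lemma smooth_add: "smooth f \<Longrightarrow> smooth g \<Longrightarrow> smooth (\<lambda>x. f x + g x)"
  by (simp add: smooth_iff_smooth_upto smooth_upto_add)

lemma smooth_mult: "smooth f \<Longrightarrow> smooth g \<Longrightarrow> smooth (\<lambda>x. f x * g x)"
  by (simp add: smooth_iff_smooth_upto smooth_upto_mult)

lemma smooth_inverse: "smooth f \<Longrightarrow> (\<And>x. f x \<noteq> 0) \<Longrightarrow> smooth (\<lambda>x. inverse (f x))"
  by (simp add: smooth_iff_smooth_upto smooth_upto_inverse)

lemma smooth_cnj: "smooth f \<Longrightarrow> smooth (\<lambda>x. cnj (f x))"
  by (simp add: smooth_iff_smooth_upto smooth_upto_bounded_linear bounded_linear_cnj)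

lemma smooth_sum: "(\<And>a. a \<in> A \<Longrightarrow> smooth (f a)) \<Longrightarrow> smooth (\<lambda>x. \<Sum>a\<in>A. f a x)"
  by (induction A rule: infinite_finite_induct) (simp_all add: smooth_add)

lemma smooth_prod: "(\<And>a. a \<in> A \<Longrightarrow> smooth (f a)) \<Longrightarrow> smooth (\<lambda>x. \<Prod>a\<in>A. f a x)"
  by (induction A rule: infinite_finite_induct) (simp_all add: smooth_mult)

lemma has_derivative_exp_linear:
  fixes L :: "'i::finite cspace \<Rightarrow> complex"
  assumes "bounded_linear L"
  shows "((\<lambda>x. exp (L x)) has_derivative (\<lambda>v. exp (L x) * L v)) (at x)"
  using diff_chain_at[OF bounded_linear_imp_has_derivative[OF assms] DERIV_exp[unfolded has_field_derivative_def]]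
  by (simp add: o_def)

lemma smooth_exp_linear:
  fixes L :: "'i::finite cspace \<Rightarrow> complex"
  assumes "bounded_linear L"
  shows "smooth (\<lambda>x. exp (L x))"
proof -
  have "smooth_upto n (\<lambda>x. exp (L x))" for n
  proof (induction n)
    case (Suc n)
    have "dir_deriv v (\<lambda>x. exp (L x)) = (\<lambda>x. exp (L x) * L v)" for v
      by (intro ext dir_deriv_eqI has_derivative_exp_linear assms)
    then have "smooth_upto n (dir_deriv v (\<lambda>x. exp (L x)))" for v
      using smooth_upto_mult[OF Suc smooth_upto_const] by auto
    then show ?case
      using has_derivative_exp_linear[OF assms] by (auto simp: differentiable_def)
  qed (use has_derivative_exp_linear[OF assms] in \<open>auto simp: differentiable_def\<close>)
  then show ?thesis by (simp add: smooth_iff_smooth_upto)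
qed

section \<open>Averages along segments\<close>

text \<open>
  Averaging over a torus \<open>\<real>\<^sup>N / \<int>\<^sup>N\<close> is done one period at a time: \<open>foldr avg vs f\<close> is the average of
  \<open>f\<close> over the parallelepiped spanned by \<open>vs\<close>.  Only one-dimensional integrals occur, and no change of
  variables on the torus is needed.
\<close>

definition avg :: "'i::finite cspace \<Rightarrow> ('i cspace \<Rightarrow> complex) \<Rightarrow> ('i cspace \<Rightarrow> complex)" where
  "avg v f = (\<lambda>x. integral {0..1} (\<lambda>t. f (x + t *\<^sub>R v)))"

lemma integrable_on_segment:
  assumes "smooth f"
  shows "(\<lambda>t. f (x + t *\<^sub>R v)) integrable_on {0..1}"
  by (intro integrable_continuous_real continuous_on_compose2[OF smooth_continuous_on[OF assms]] continuous_intros)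
    auto

text \<open>
  Differentiation under the integral sign.
\<close>

lemma has_derivative_avg:
  fixes f :: "'i::finite cspace \<Rightarrow> complex"
  assumes f: "smooth f"
  shows "(avg v f has_derivative (\<lambda>u. avg v (dir_deriv u f) x)) (at x)"
proof -
  define D where "D = (\<lambda>x t. Blinfun (\<lambda>u. dir_deriv u f (x + t *\<^sub>R v)))"
  have D: "blinfun_apply (D x t) = (\<lambda>u. dir_deriv u f (x + t *\<^sub>R v))" for x t
    unfolding D_def
    using has_derivative_bounded_linear[OF has_derivative_dir_deriv[OF smooth_differentiable[OF f]]]
    by (rule bounded_linear_Blinfun_apply)
  have cont: "continuous_on (UNIV \<times> cbox 0 (1::real)) (\<lambda>(x, t). D x t)"
    unfolding case_prod_beta
    by (intro continuous_on_blinfun_componentwise)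
      (auto simp: D intro!: continuous_intros continuous_on_compose2[OF smooth_continuous_on] smooth_dir_deriv f)
  have int: "D x integrable_on cbox 0 1" for x
    by (intro integrable_continuous continuous_on_blinfun_componentwise)
      (auto simp: D intro!: continuous_intros continuous_on_compose2[OF smooth_continuous_on] smooth_dir_deriv f)
  have "((\<lambda>x. integral (cbox 0 1) (\<lambda>t. f (x + t *\<^sub>R v)))
      has_derivative blinfun_apply (integral (cbox 0 1) (D x))) (at x within UNIV)"
  proof (rule leibniz_rule[OF _ _ cont])
    show "((\<lambda>x. f (x + t *\<^sub>R v)) has_derivative blinfun_apply (D x t)) (at x within UNIV)" for x t
    proof -
      have "(f \<circ> (\<lambda>x. x + t *\<^sub>R v) has_derivative (\<lambda>u. dir_deriv u f (x + t *\<^sub>R v)) \<circ> (\<lambda>u. u)) (at x)"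
        by (intro diff_chain_at has_derivative_dir_deriv smooth_differentiable f)
          (auto intro!: derivative_eq_intros)
      then show ?thesis by (simp add: D o_def)
    qed
  qed (auto simp: integrable_on_segment f)
  moreover have "blinfun_apply (integral (cbox 0 1) (D x)) = (\<lambda>u. avg v (dir_deriv u f) x)"
    by (auto simp: blinfun_apply_integral[OF int[unfolded cbox_interval]] D avg_def)
  ultimately show ?thesis by (simp add: avg_def)
qed

lemma dir_deriv_avg: "smooth f \<Longrightarrow> dir_deriv u (avg v f) = avg v (dir_deriv u f)"
  by (intro ext dir_deriv_eqI has_derivative_avg)

lemma smooth_avg:
  assumes "smooth f" shows "smooth (avg v f)"
proof -
  have "smooth_upto n (avg v f)" if "smooth f" for n f
    using that
  proof (induction n arbitrary: f)
    case (Suc n)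
    then show ?case
      using has_derivative_avg[OF Suc.prems] by (auto simp: differentiable_def dir_deriv_avg smooth_dir_deriv)
  qed (use has_derivative_avg in \<open>auto simp: differentiable_def\<close>)
  with assms show ?thesis by (simp add: smooth_iff_smooth_upto)
qed

lemma has_vector_derivative_along_line:
  assumes "smooth f"
  shows "((\<lambda>t. f (x + t *\<^sub>R v)) has_vector_derivative dir_deriv v f (x + t *\<^sub>R v)) (at t within S)"
proof -
  have "(f \<circ> (\<lambda>t. x + t *\<^sub>R v) has_derivative
      (\<lambda>u. dir_deriv u f (x + t *\<^sub>R v)) \<circ> (\<lambda>s. s *\<^sub>R v)) (at t)"
    by (intro diff_chain_at has_derivative_dir_deriv smooth_differentiable assms)
      (auto intro!: derivative_eq_intros)
  moreover have "dir_deriv (s *\<^sub>R v) f y = s *\<^sub>R dir_deriv v f y" for s y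
    using has_derivative_linear[OF has_derivative_dir_deriv[OF smooth_differentiable[OF assms]]]
    by (rule linear_cmul)
  ultimately show ?thesis
    by (auto simp: has_vector_derivative_def o_def intro: has_derivative_at_withinI)
qed

lemma avg_dir_deriv_self:
  assumes "smooth f"
  shows "avg v (dir_deriv v f) x = f (x + v) - f x"
proof -
  have "((\<lambda>t. dir_deriv v f (x + t *\<^sub>R v)) has_integral f (x + 1 *\<^sub>R v) - f (x + 0 *\<^sub>R v)) {0..1}"
    by (intro fundamental_theorem_of_calculus has_vector_derivative_along_line assms) auto
  then show ?thesis by (simp add: avg_def integral_unique)
qed

lemma affine_along_line:
  assumes f: "smooth f" and 0: "dir_deriv v (dir_deriv v f) = (\<lambda>x. 0)"
  shows "f (x + t *\<^sub>R v) = f x + of_real t * dir_deriv v f x"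
proof -
  have "((\<lambda>t. dir_deriv v f (x + t *\<^sub>R v)) has_vector_derivative 0) (at t within UNIV)" for t
    using has_vector_derivative_along_line[OF smooth_dir_deriv[OF f], of v x v t UNIV] 0 by simp
  then obtain c where c: "\<And>t. dir_deriv v f (x + t *\<^sub>R v) = c"
    using has_vector_derivative_zero_constant[of UNIV] by (metis UNIV_I convex_UNIV)
  have "((\<lambda>t. f (x + t *\<^sub>R v) - t *\<^sub>R c) has_vector_derivative 0) (at t within UNIV)" for t
    using has_vector_derivative_along_line[OF f, of x v t UNIV]
    unfolding c by (auto intro!: derivative_eq_intros)
  then obtain d where d: "\<And>t. f (x + t *\<^sub>R v) - t *\<^sub>R c = d"
    using has_vector_derivative_zero_constant[of UNIV "\<lambda>t. f (x + t *\<^sub>R v) - t *\<^sub>R c"]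
    by (metis UNIV_I convex_UNIV)
  show ?thesis using d[of t] d[of 0] c[of 0] by (simp add: algebra_simps scaleR_conv_of_real)
qed

lemma avg_zero [simp]: "avg v (\<lambda>x. 0) = (\<lambda>x. 0)"
  by (simp add: avg_def)

lemma avg_periodic: "(\<And>x. f (x + p) = f x) \<Longrightarrow> avg v f (x + p) = avg v f x"
proof -
  assume f: "\<And>x. f (x + p) = f x"
  have "f (x + p + t *\<^sub>R v) = f (x + t *\<^sub>R v)" for t
    using f[of "x + t *\<^sub>R v"] by (simp add: add_ac)
  then show ?thesis by (simp add: avg_def)
qed

lemma avg_mult_left: "avg v (\<lambda>x. c * f x) = (\<lambda>x. c * avg v f x)"
  by (simp add: avg_def)

lemma avg_add:
  assumes "smooth f" "smooth g"
  shows "avg v (\<lambda>x. f x + g x) = (\<lambda>x. avg v f x + avg v g x)"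
  by (simp add: avg_def integral_add integrable_on_segment assms)

lemma Re_avg_pos:
  assumes "smooth f" "\<And>x. 0 < Re (f x)"
  shows "0 < Re (avg v f x)"
proof -
  let ?r = "\<lambda>t. Re (f (x + t *\<^sub>R v))"
  have "continuous_on {0..1} ?r"
    by (intro continuous_intros continuous_on_compose2[OF smooth_continuous_on[OF assms(1)]]) auto
  then obtain t0 where t0: "\<And>t. t \<in> {0..1} \<Longrightarrow> ?r t0 \<le> ?r t"
    using continuous_attains_inf[of "{0..1::real}" ?r] compact_Icc
    by (metis atLeastAtMost_iff empty_iff order_refl zero_le_one)
  have int: "?r integrable_on {0..1}" and eq: "integral {0..1} ?r = Re (avg v f x)"
    using integrable_linear[OF integrable_on_segment[OF assms(1)] bounded_linear_Re]
      integral_linear[OF integrable_on_segment[OF assms(1)] bounded_linear_Re]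
    by (auto simp: avg_def o_def)
  have "integral {0..1::real} (\<lambda>t. ?r t0) \<le> integral {0..1} ?r"
    by (intro integral_le int t0) auto
  then show ?thesis using assms(2)[of "x + t0 *\<^sub>R v"] eq by simp
qed

lemma norm_avg_le:
  assumes "smooth f" "\<And>t. norm (f (x + t *\<^sub>R v)) \<le> C"
  shows "norm (avg v f x) \<le> C"
  using integral_norm_bound_integral[OF integrable_on_segment[OF assms(1), of x v], of "\<lambda>_. C"] assms(2)
    integrable_const_ivl[of C 0 1]
  by (simp add: avg_def)

lemma smooth_avgs: "smooth f \<Longrightarrow> smooth (foldr avg vs f)"
  by (induction vs) (auto simp: smooth_avg)

lemma avgs_zero [simp]: "foldr avg vs (\<lambda>x. 0) = (\<lambda>x. 0)"
  by (induction vs) auto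

lemma avgs_mult_left: "foldr avg vs (\<lambda>x. c * f x) = (\<lambda>x. c * foldr avg vs f x)"
  by (induction vs) (simp_all add: avg_mult_left)

lemma avgs_add:
  assumes "smooth f" "smooth g"
  shows "foldr avg vs (\<lambda>x. f x + g x) = (\<lambda>x. foldr avg vs f x + foldr avg vs g x)"
  using assms by (induction vs) (simp_all add: avg_add smooth_avgs)

lemma avgs_sum:
  assumes "\<And>a. a \<in> A \<Longrightarrow> smooth (f a)"
  shows "foldr avg vs (\<lambda>x. \<Sum>a\<in>A. f a x) = (\<lambda>x. \<Sum>a\<in>A. foldr avg vs (f a) x)"
  using assms
proof (induction A rule: infinite_finite_induct)
  case (insert a A)
  then show ?case by (simp add: avgs_add smooth_sum)
qed auto

lemma dir_deriv_avgs: "smooth f \<Longrightarrow> dir_deriv u (foldr avg vs f) = foldr avg vs (dir_deriv u f)"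
  by (induction vs) (auto simp: dir_deriv_avg smooth_avgs)

lemma avgs_periodic: "(\<And>x. f (x + p) = f x) \<Longrightarrow> foldr avg vs f (x + p) = foldr avg vs f x"
  by (induction vs arbitrary: x) (auto intro: avg_periodic)

text \<open>
  The average in direction \<open>v\<close> of the derivative in direction \<open>v\<close> is the difference of the values at the
  two ends of a period, hence \<open>0\<close>; the other averages commute with the derivative.
\<close>

lemma dir_deriv_avgs_eq_0:
  assumes "smooth f" "\<And>p x. p \<in> set vs \<Longrightarrow> f (x + p) = f x" "v \<in> set vs"
  shows "dir_deriv v (foldr avg vs f) = (\<lambda>x. 0)"
  using assms(2,3)
proof (induction vs)
  case (Cons u vs)
  have eq: "dir_deriv v (foldr avg (u # vs) f) = avg u (dir_deriv v (foldr avg vs f))"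
    by (simp add: dir_deriv_avg smooth_avgs assms(1))
  show ?case
  proof (cases "v = u")
    case True
    have "foldr avg vs f (x + u) = foldr avg vs f x" for x
      by (rule avgs_periodic) (simp add: Cons.prems)
    then show ?thesis
      unfolding eq by (simp add: True avg_dir_deriv_self smooth_avgs assms(1) fun_eq_iff)
  next
    case False
    with Cons have "dir_deriv v (foldr avg vs f) = (\<lambda>x. 0)" by simp
    then show ?thesis unfolding eq by simp
  qed
qed auto

lemma dir_deriv_avgs_span_eq_0:
  assumes "smooth f" "\<And>p x. p \<in> set vs \<Longrightarrow> f (x + p) = f x" "v \<in> span (set vs)"
  shows "dir_deriv v (foldr avg vs f) = (\<lambda>x. 0)"
proof
  fix x
  have "linear (\<lambda>v. dir_deriv v (foldr avg vs f) x)"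
    by (intro has_derivative_linear[OF has_derivative_dir_deriv] smooth_differentiable smooth_avgs assms(1))
  then show "dir_deriv v (foldr avg vs f) x = 0"
    using linear_eq_0_on_span[OF _ _ assms(3), of "\<lambda>v. dir_deriv v (foldr avg vs f) x"]
      dir_deriv_avgs_eq_0[OF assms(1,2)] by auto
qed

lemma Re_avgs_pos: "smooth f \<Longrightarrow> (\<And>x. 0 < Re (f x)) \<Longrightarrow> 0 < Re (foldr avg vs f x)"
  by (induction vs arbitrary: x) (auto intro: Re_avg_pos smooth_avgs)

lemma norm_avgs_le:
  assumes "smooth f" "\<And>x. x \<in> X \<Longrightarrow> norm (f x) \<le> C"
    "\<And>x v t. x \<in> X \<Longrightarrow> v \<in> set vs \<Longrightarrow> x + t *\<^sub>R v \<in> X" "x \<in> X"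
  shows "norm (foldr avg vs f x) \<le> C"
  using assms(3,4)
  by (induction vs arbitrary: x) (auto intro!: norm_avg_le smooth_avgs assms(1,2))

section \<open>Determinants, minors and positive definite matrices\<close>

lemma smooth_det:
  fixes A :: "'i::finite cspace \<Rightarrow> complex ^ 'a ^ 'a::finite"
  assumes "\<And>k l. smooth (\<lambda>x. A x $ k $ l)"
  shows "smooth (\<lambda>x. det (A x))"
  unfolding det_def by (intro smooth_sum smooth_mult smooth_prod smooth_const assms)

lemma smooth_minor:
  assumes "\<And>s t. smooth (\<lambda>x. a x s t)"
  shows "smooth (\<lambda>x. minor (a x) S T)"
proof (cases "card S = card T")
  case True
  then show ?thesis
    unfolding minor_def by (simp, intro smooth_sum smooth_mult smooth_prod smooth_const assms)
qed (simp add: minor_def)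

lemma det_scale:
  fixes A :: "complex ^ 'a ^ 'a::finite"
  shows "det (\<chi> k l. r k * A $ k $ l * r l) = (\<Prod>k\<in>UNIV. r k)\<^sup>2 * det A"
proof -
  have "(\<Prod>i\<in>UNIV. (\<chi> k l. r k * A $ k $ l * r l) $ i $ p i) =
      (\<Prod>k\<in>UNIV. r k)\<^sup>2 * (\<Prod>i\<in>UNIV. A $ i $ p i)" if "p permutes UNIV" for p
    using prod.permute[OF that, of r] by (simp add: prod.distrib power2_eq_square o_def mult_ac)
  then show ?thesis
    unfolding det_def sum_distrib_left by (intro sum.cong) (auto simp: mult_ac)
qed

text \<open>
  The definition of \<open>minor\<close> sums over permutations of list positions.  Padding the submatrix by an identity
  block gives a determinant over the index type itself, to which the library applies.
\<close>

lemma minor_eq_det: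
  fixes a :: "'a::{finite,linorder} \<Rightarrow> 'a \<Rightarrow> complex"
  shows "minor a S S = det (\<chi> s t. if s \<in> S \<and> t \<in> S then a s t else if s = t then 1 else 0)"
    (is "_ = det ?A")
proof -
  let ?n = "card S"
  define f where "f = (!) (sorted_list_of_set S)"
  define g where "g = inv_into {..<?n} f"
  have bij: "bij_betw f {..<?n} S"
    using bij_betw_nth[of "sorted_list_of_set S" "{..<?n}" S] by (simp add: f_def)
  then have inj: "inj_on f {..<?n}" by (simp add: bij_betw_def)
  have bij': "bij_betw g S {..<?n}" unfolding g_def by (rule bij_betw_inv_into[OF bij])
  have gf: "g (f r) = r" if "r \<in> {..<?n}" for r
    using inj that by (simp add: g_def)
  have fg: "f (g s) = s" if "s \<in> S" for s
    using bij that unfolding g_def by (metis bij_betw_inv_into_right)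
  have "minor a S S = (\<Sum>\<sigma> | \<sigma> permutes {..<?n}. of_int (sign \<sigma>) * (\<Prod>r<?n. a (f r) (f (\<sigma> r))))"
    by (simp add: minor_def f_def)
  also have "\<dots> = (\<Sum>p | p permutes S. of_int (sign p) * (\<Prod>s\<in>S. a s (p s)))"
  proof (rule sum.reindex_bij_witness[where i = "map_permutation S g" and j = "map_permutation {..<?n} f"])
    fix \<sigma> assume "\<sigma> \<in> {\<sigma>. \<sigma> permutes {..<?n}}"
    then have \<sigma>: "\<sigma> permutes {..<?n}" by simp
    show "map_permutation {..<?n} f \<sigma> \<in> {p. p permutes S}"
      using map_permutation_permutes[OF bij \<sigma>] by simp
    show "map_permutation S g (map_permutation {..<?n} f \<sigma>) = \<sigma>"
      using map_permutation_compose_inv[OF bij \<sigma>] gf by blast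
    have "(\<Prod>s\<in>S. a s (map_permutation {..<?n} f \<sigma> s)) = (\<Prod>r<?n. a (f r) (f (\<sigma> r)))"
      by (subst prod.reindex_bij_betw[OF bij, symmetric])
        (intro prod.cong refl, simp add: map_permutation_apply[OF inj])
    then show "of_int (sign (map_permutation {..<?n} f \<sigma>)) * (\<Prod>s\<in>S. a s (map_permutation {..<?n} f \<sigma> s)) =
        of_int (sign \<sigma>) * (\<Prod>r<?n. a (f r) (f (\<sigma> r)))"
      by (simp add: sign_map_permutation[OF inj \<sigma>])
  next
    fix p assume "p \<in> {p. p permutes S}"
    then have p: "p permutes S" by simp
    show "map_permutation S g p \<in> {\<sigma>. \<sigma> permutes {..<?n}}"
      using map_permutation_permutes[OF bij' p] by simp
    show "map_permutation {..<?n} f (map_permutation S g p) = p"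
      using map_permutation_compose_inv[OF bij' p] fg by blast
  qed
  also have "\<dots> = (\<Sum>p | p permutes S. of_int (sign p) * (\<Prod>s\<in>UNIV. ?A $ s $ p s))"
  proof (intro sum.cong refl, clarsimp)
    fix p assume p: "p permutes S"
    have "(\<Prod>s\<in>UNIV. ?A $ s $ p s) = (\<Prod>s\<in>S. ?A $ s $ p s)"
      using p by (intro prod.mono_neutral_right) (auto simp: permutes_not_in)
    also have "\<dots> = (\<Prod>s\<in>S. a s (p s))"
      using p by (intro prod.cong) (auto simp: permutes_in_image)
    finally show "(\<Prod>s\<in>S. a s (p s)) =
        (\<Prod>s\<in>UNIV. if s \<in> S \<and> p s \<in> S then a s (p s) else if s = p s then 1 else 0)"
      by simp
  qed
  also have "\<dots> = det ?A"
    unfolding det_def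
  proof (rule sum.mono_neutral_left)
    show "\<forall>p\<in>{p. p permutes UNIV} - {p. p permutes S}.
        of_int (sign p) * (\<Prod>s\<in>UNIV. ?A $ s $ p s) = 0"
    proof
      fix p assume p: "p \<in> {p. p permutes UNIV} - {p. p permutes S}"
      then obtain s where "s \<notin> S" "p s \<noteq> s"
        by (auto simp: permutes_def)
      then have "\<exists>s. ?A $ s $ p s = 0" by (intro exI[of _ s]) auto
      then have "(\<Prod>s\<in>UNIV. ?A $ s $ p s) = 0" by (meson UNIV_I finite prod_zero)
      then show "of_int (sign p) * (\<Prod>s\<in>UNIV. ?A $ s $ p s) = 0" by simp
    qed
  qed (auto simp: finite_permutations intro: permutes_subset)
  finally show ?thesis .
qed

lemma minor_scale:
  fixes a :: "'a::{finite,linorder} \<Rightarrow> 'a \<Rightarrow> complex"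
  shows "minor (\<lambda>s t. r s * a s t * r t) S S = (\<Prod>s\<in>S. r s)\<^sup>2 * minor a S S"
proof -
  let ?A = "\<chi> s t. if s \<in> S \<and> t \<in> S then a s t else if s = t then 1 else 0"
  let ?r = "\<lambda>s. if s \<in> S then r s else 1"
  have "minor (\<lambda>s t. r s * a s t * r t) S S = det (\<chi> s t. ?r s * ?A $ s $ t * ?r t)"
    unfolding minor_eq_det by (intro arg_cong[of _ _ det]) (auto simp: vec_eq_iff)
  also have "\<dots> = (\<Prod>s\<in>UNIV. ?r s)\<^sup>2 * minor a S S"
    unfolding det_scale minor_eq_det ..
  also have "(\<Prod>s\<in>UNIV. ?r s) = (\<Prod>s\<in>S. r s)"
    by (simp add: prod.If_cases)
  finally show ?thesis .
qed

lemma minor_eq_0: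
  assumes "s \<in> S" "\<And>t. t \<in> T \<Longrightarrow> a s t = 0"
  shows "minor a S T = 0"
proof (cases "card S = card T")
  case True
  obtain r where r: "r < card S" "sorted_list_of_set S ! r = s"
    using assms(1) by (metis distinct_sorted_list_of_set finite in_set_conv_nth length_sorted_list_of_set
        set_sorted_list_of_set)
  have "(\<Prod>r<card S. a (sorted_list_of_set S ! r) (sorted_list_of_set T ! \<sigma> r)) = 0"
    if "\<sigma> permutes {..<card S}" for \<sigma>
  proof (rule prod_zero)
    have "\<sigma> r < card T" using permutes_in_image[OF that, of r] r True by simp
    then have "sorted_list_of_set T ! \<sigma> r \<in> T"
      by (metis finite length_sorted_list_of_set nth_mem set_sorted_list_of_set)
    then show "\<exists>r\<in>{..<card S}. a (sorted_list_of_set S ! r) (sorted_list_of_set T ! \<sigma> r) = 0"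
      using r assms(2) by auto
  qed auto
  then show ?thesis unfolding minor_def by (auto intro!: sum.neutral)
qed (simp add: minor_def)

lemma minor_diagonal:
  assumes "\<And>s t. s \<noteq> t \<Longrightarrow> a s t = 0"
  shows "minor a S T = (if S = T then \<Prod>s\<in>S. a s s else 0)"
proof (cases "S = T")
  case True
  have "minor a S S = (\<Prod>s\<in>UNIV. if s \<in> S then a s s else 1)"
    unfolding minor_eq_det by (subst det_diagonal) (auto simp: assms intro!: prod.cong)
  then show ?thesis using True by (simp add: prod.If_cases)
next
  case False
  show ?thesis
  proof (cases "card S = card T")
    case True
    then obtain s where s: "s \<in> S" "s \<notin> T"
      using False by (metis card_subset_eq finite subsetI)
    then have "minor a S T = 0"
      by (intro minor_eq_0[of s]) (auto intro: assms)
    then show ?thesis using False by simp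
  qed (use False in \<open>simp add: minor_def\<close>)
qed

definition posdef_hermitian :: "complex ^ 'a ^ 'a::finite \<Rightarrow> bool" where
  "posdef_hermitian A \<longleftrightarrow> (\<forall>k l. A $ l $ k = cnj (A $ k $ l)) \<and>
    (\<forall>v. v \<noteq> 0 \<longrightarrow> 0 < Re (\<Sum>k\<in>UNIV. \<Sum>l\<in>UNIV. v $ k * A $ k $ l * cnj (v $ l)))"

lemma
  assumes "posdef_hermitian A"
  shows posdef_hermitian_cnj: "A $ l $ k = cnj (A $ k $ l)"
    and posdef_hermitian_pos: "v \<noteq> 0 \<Longrightarrow> 0 < Re (\<Sum>k\<in>UNIV. \<Sum>l\<in>UNIV. v $ k * A $ k $ l * cnj (v $ l))"
  using assms unfolding posdef_hermitian_def by blast+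

lemma posdef_hermitian_ker:
  assumes "posdef_hermitian A" "A *v x = 0"
  shows "x = 0"
proof (rule ccontr)
  assume "x \<noteq> 0"
  then have "(\<chi> k. cnj (x $ k)) \<noteq> 0" by (simp add: vec_eq_iff)
  then have "0 < Re (\<Sum>k\<in>UNIV. cnj (x $ k) * (\<Sum>l\<in>UNIV. A $ k $ l * x $ l))"
    using posdef_hermitian_pos[OF assms(1), of "\<chi> k. cnj (x $ k)"]
    by (simp add: sum_distrib_left mult.assoc)
  moreover have "(\<Sum>l\<in>UNIV. A $ k $ l * x $ l) = 0" for k
    using assms(2) by (simp add: matrix_vector_mult_def vec_eq_iff)
  ultimately show False by simp
qed

lemma posdef_hermitian_det_nonzero: "posdef_hermitian A \<Longrightarrow> det A \<noteq> 0"
  using posdef_hermitian_ker matrix_left_invertible_ker[of A]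
  by (metis invertible_det_nz invertible_left_inverse)

lemma det_cnj: "det (\<chi> k l. cnj (A $ k $ l)) = cnj (det A)"
  by (simp add: det_def)

lemma hermitian_det_real:
  assumes "\<And>k l. A $ l $ k = cnj (A $ k $ l)"
  shows "Im (det A) = 0"
proof -
  have "transpose A = (\<chi> k l. cnj (A $ k $ l))"
    unfolding transpose_def by (subst vec_eq_iff)+ (auto intro: assms)
  then have "det A = cnj (det A)"
    by (metis det_cnj det_transpose)
  then show ?thesis by (simp add: complex_eq_iff)
qed

text \<open>
  The determinant is real by Hermitian symmetry and does not vanish on the segment from the identity
  matrix to \<open>A\<close>, all of whose points are positive definite; so its sign is that at the identity.
\<close>

lemma posdef_hermitian_det_pos:
  fixes A :: "complex ^ 'a ^ 'a::finite"
  assumes A: "posdef_hermitian A"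
  shows "Im (det A) = 0" "0 < Re (det A)"
proof -
  show "Im (det A) = 0"
    by (rule hermitian_det_real[OF posdef_hermitian_cnj[OF A]])
  define B where "B = (\<lambda>t. \<chi> k l. of_real (1 - t) * (if k = l then 1 else 0) + of_real t * A $ k $ l)"
  have B: "posdef_hermitian (B t)" if t: "0 \<le> t" "t \<le> 1" for t
  proof -
    have "0 < Re (\<Sum>k\<in>UNIV. \<Sum>l\<in>UNIV. v $ k * B t $ k $ l * cnj (v $ l))" if "v \<noteq> 0" for v
    proof -
      have "(\<Sum>l\<in>UNIV. v $ k * B t $ k $ l * cnj (v $ l)) =
          of_real (1 - t) * of_real ((cmod (v $ k))\<^sup>2) +
          of_real t * (\<Sum>l\<in>UNIV. v $ k * A $ k $ l * cnj (v $ l))" for k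
      proof -
        have "v $ k * B t $ k $ l * cnj (v $ l) =
            (if k = l then of_real (1 - t) * (v $ k * cnj (v $ k)) else 0) +
            of_real t * (v $ k * A $ k $ l * cnj (v $ l))" for l
          by (simp add: B_def algebra_simps)
        then show ?thesis
          by (simp add: sum.distrib sum_distrib_left complex_norm_square[symmetric] del: of_real_diff)
      qed
      then have "(\<Sum>k\<in>UNIV. \<Sum>l\<in>UNIV. v $ k * B t $ k $ l * cnj (v $ l)) =
          of_real (1 - t) * of_real (\<Sum>k\<in>UNIV. (cmod (v $ k))\<^sup>2) +
          of_real t * (\<Sum>k\<in>UNIV. \<Sum>l\<in>UNIV. v $ k * A $ k $ l * cnj (v $ l))"
        by (simp only: sum.distrib of_real_sum flip: sum_distrib_left)
      then have "Re (\<Sum>k\<in>UNIV. \<Sum>l\<in>UNIV. v $ k * B t $ k $ l * cnj (v $ l)) =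
          (1 - t) * (\<Sum>k\<in>UNIV. (cmod (v $ k))\<^sup>2) +
          t * Re (\<Sum>k\<in>UNIV. \<Sum>l\<in>UNIV. v $ k * A $ k $ l * cnj (v $ l))"
        by (simp del: Re_sum of_real_sum of_real_power)
      moreover have "0 < (\<Sum>k\<in>UNIV. (cmod (v $ k))\<^sup>2)"
      proof -
        obtain k where "v $ k \<noteq> 0" using \<open>v \<noteq> 0\<close> by (auto simp: vec_eq_iff)
        then show ?thesis by (intro sum_pos2[of _ k]) auto
      qed
      moreover have "0 < Re (\<Sum>k\<in>UNIV. \<Sum>l\<in>UNIV. v $ k * A $ k $ l * cnj (v $ l))"
        using posdef_hermitian_pos[OF A \<open>v \<noteq> 0\<close>] .
      ultimately show ?thesis
        using t by (cases "t = 0") (auto intro!: add_nonneg_pos mult_nonneg_nonneg)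
    qed
    moreover have "B t $ l $ k = cnj (B t $ k $ l)" for k l
      by (simp add: B_def posdef_hermitian_cnj[OF A, of k l])
    ultimately show ?thesis unfolding posdef_hermitian_def by blast
  qed
  show "0 < Re (det A)"
  proof (rule ccontr)
    assume "\<not> 0 < Re (det A)"
    moreover have "B 1 = A" by (simp add: B_def vec_eq_iff)
    moreover have "B 0 = mat 1" by (simp add: B_def mat_def vec_eq_iff)
    moreover have "continuous_on {0..1} (\<lambda>t. Re (det (B t)))"
      unfolding det_def B_def by (intro continuous_intros)
    ultimately obtain t where t: "0 \<le> t" "t \<le> 1" "Re (det (B t)) = 0"
      using IVT2'[of "\<lambda>t. Re (det (B t))" 1 0 0] by auto
    then have "det (B t) = 0"
      using hermitian_det_real[OF posdef_hermitian_cnj[OF B[OF t(1,2)]]]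
      by (simp add: complex_eq_iff)
    then show False using posdef_hermitian_det_nonzero[OF B[OF t(1,2)]] by simp
  qed
qed

text \<open>
  The padded matrix of \<open>minor_eq_det\<close> is again positive definite.
\<close>

lemma posdef_minor_pos:
  fixes a :: "'a::{finite,linorder} \<Rightarrow> 'a \<Rightarrow> complex"
  assumes herm: "\<And>s t. a t s = cnj (a s t)"
    and pos: "\<And>c. c \<noteq> (\<lambda>s. 0) \<Longrightarrow> 0 < Re (\<Sum>s\<in>UNIV. \<Sum>t\<in>UNIV. c s * a s t * cnj (c t))"
  shows "Im (minor a S S) = 0" "0 < Re (minor a S S)"
proof -
  let ?A = "\<chi> s t. if s \<in> S \<and> t \<in> S then a s t else if s = t then 1 else 0"
  have "posdef_hermitian ?A"
  proof -
    have "0 < Re (\<Sum>s\<in>UNIV. \<Sum>t\<in>UNIV. v $ s * ?A $ s $ t * cnj (v $ t))" if "v \<noteq> 0" for v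
    proof -
      define c where "c = (\<lambda>s. if s \<in> S then v $ s else 0)"
      have "(\<Sum>t\<in>UNIV. v $ s * ?A $ s $ t * cnj (v $ t)) =
          (\<Sum>t\<in>UNIV. c s * a s t * cnj (c t)) + of_real (if s \<in> S then 0 else (cmod (v $ s))\<^sup>2)" for s
      proof (cases "s \<in> S")
        case True
        then show ?thesis by (auto simp: c_def intro!: sum.cong)
      next
        case False
        then have "v $ s * ?A $ s $ t * cnj (v $ t) = (if t = s then v $ s * cnj (v $ s) else 0)" for t
          by auto
        then show ?thesis using False by (simp add: c_def complex_norm_square[symmetric])
      qed
      then have "Re (\<Sum>s\<in>UNIV. \<Sum>t\<in>UNIV. v $ s * ?A $ s $ t * cnj (v $ t)) =
          Re (\<Sum>s\<in>UNIV. \<Sum>t\<in>UNIV. c s * a s t * cnj (c t)) +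
          (\<Sum>s\<in>UNIV. if s \<in> S then 0 else (cmod (v $ s))\<^sup>2)" (is "_ = ?x + ?y")
        by (simp add: sum.distrib)
      moreover have "0 \<le> ?y" by (intro sum_nonneg) auto
      moreover have "0 < ?y" if "c = (\<lambda>s. 0)"
      proof -
        obtain s where s: "v $ s \<noteq> 0" using \<open>v \<noteq> 0\<close> by (auto simp: vec_eq_iff)
        with that have "s \<notin> S" by (auto simp: c_def fun_eq_iff split: if_splits)
        with s show ?thesis by (intro sum_pos2[of _ s]) auto
      qed
      ultimately show ?thesis using pos[of c] by (cases "c = (\<lambda>s. 0)") auto
    qed
    moreover have "?A $ t $ s = cnj (?A $ s $ t)" for s t
      by (simp add: herm[of t s])
    ultimately show ?thesis unfolding posdef_hermitian_def by blast
  qed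
  from posdef_hermitian_det_pos[OF this]
  show "Im (minor a S S) = 0" "0 < Re (minor a S S)" unfolding minor_eq_det by auto
qed

section \<open>Hermitian metrics and the Hodge star\<close>

declare wirtinger.simps [simp del]

lemma sum_gen: "(\<Sum>s\<in>UNIV. f s) = (\<Sum>k\<in>UNIV. f (Dz k)) + (\<Sum>k\<in>UNIV. f (Dzb k))"
  for f :: "'i::finite gen \<Rightarrow> 'b::comm_monoid_add"
proof -
  have U: "UNIV = range Dz \<union> range (Dzb :: 'i \<Rightarrow> _)"
    by (metis UNIV_eq_I UnCI gen.exhaust rangeI)
  have "(\<Sum>s\<in>UNIV. f s) = (\<Sum>s\<in>range Dz. f s) + (\<Sum>s\<in>range Dzb. f s)"
    unfolding U by (intro sum.union_disjoint) auto
  then show ?thesis by (simp add: sum.reindex inj_on_def)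
qed

lemma matrix_inv_inverse:
  fixes A :: "complex ^ 'a ^ 'a::finite"
  assumes "det A \<noteq> 0"
  shows "A ** matrix_inv A = mat 1" "matrix_inv A ** A = mat 1"
proof -
  have "\<exists>B. A ** B = mat 1 \<and> B ** A = mat 1"
    using assms by (simp add: invertible_det_nz[symmetric] invertible_def)
  then have "A ** matrix_inv A = mat 1 \<and> matrix_inv A ** A = mat 1"
    unfolding matrix_inv_def by (rule someI_ex)
  then show "A ** matrix_inv A = mat 1" "matrix_inv A ** A = mat 1" by auto
qed

lemma matrix_inv_eqI:
  fixes A :: "complex ^ 'a ^ 'a::finite"
  assumes "B ** A = mat 1"
  shows "matrix_inv A = B"
proof -
  have "det B * det A = 1" using assms by (metis det_I det_mul)
  then have "det A \<noteq> 0" by auto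
  then show ?thesis
    using assms by (metis matrix_inv_inverse(1) matrix_mul_assoc matrix_mul_lid matrix_mul_rid)
qed

text \<open>
  By Cramer's rule the entries of the inverse are quotients of polynomials in the entries.
\<close>

lemma smooth_matrix_inv:
  fixes A :: "'i::finite cspace \<Rightarrow> complex ^ 'a ^ 'a::finite"
  assumes A: "\<And>k l. smooth (\<lambda>x. A x $ k $ l)" and det: "\<And>x. det (A x) \<noteq> 0"
  shows "smooth (\<lambda>x. matrix_inv (A x) $ k $ l)"
proof -
  have "matrix_inv (A x) $ k $ l =
      det (\<chi> i j. if j = k then axis l 1 $ i else A x $ i $ j) * inverse (det (A x))" for x
  proof -
    have "A x *v (matrix_inv (A x) *v axis l 1) = axis l 1"
      by (simp add: matrix_vector_mul_assoc matrix_inv_inverse det)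
    then have "matrix_inv (A x) *v axis l 1 =
        (\<chi> k. det (\<chi> i j. if j = k then axis l 1 $ i else A x $ i $ j) / det (A x))"
      using cramer[OF det] by blast
    moreover have "(matrix_inv (A x) *v axis l 1) $ k = matrix_inv (A x) $ k $ l"
      by (simp add: matrix_vector_mult_def axis_def if_distrib[of "\<lambda>u. _ * u"] cong: if_cong)
    ultimately show ?thesis by (simp add: divide_inverse)
  qed
  moreover have "smooth (\<lambda>x. det (\<chi> i j. if j = k then axis l 1 $ i else A x $ i $ j))"
  proof (rule smooth_det)
    show "smooth (\<lambda>x. (\<chi> i j. if j = k then axis l 1 $ i else A x $ i $ j) $ i $ j)" for i j
      using A[of i j] by (cases "j = k") auto
  qed
  ultimately show ?thesis
    using smooth_mult[OF _ smooth_inverse[OF smooth_det[OF A] det]] by auto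
qed

text \<open>
  With \<open>u = matrix_inv H *v v'\<close>, where \<open>v'\<close> is the conjugate of \<open>v\<close>, the form of the inverse at \<open>v\<close> is the
  conjugate of the form of \<open>H\<close> at the conjugate of \<open>u\<close>.
\<close>

lemma posdef_hermitian_matrix_inv:
  assumes H: "posdef_hermitian H"
  shows "posdef_hermitian (matrix_inv H)"
proof -
  let ?G = "matrix_inv H"
  let ?G' = "\<chi> k l. cnj (?G $ l $ k)"
  have inv: "H ** ?G = mat 1" using matrix_inv_inverse posdef_hermitian_det_nonzero[OF H] by blast
  have "?G' ** H = mat 1"
  proof -
    have "(?G' ** H) $ k $ l = cnj ((H ** ?G) $ l $ k)" for k l
    proof -
      have "cnj (?G $ j $ k) * H $ j $ l = cnj (H $ l $ j * ?G $ j $ k)" for j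
        by (simp add: posdef_hermitian_cnj[OF H, of j l] mult.commute)
      then show ?thesis by (simp add: matrix_matrix_mult_def del: complex_cnj_mult)
    qed
    then show ?thesis unfolding inv by (simp add: vec_eq_iff mat_def)
  qed
  from arg_cong[OF matrix_inv_eqI[OF this], of "\<lambda>X. X $ l $ k" for k l]
  have "?G $ l $ k = cnj (?G $ k $ l)" for k l unfolding vec_lambda_beta .
  moreover have "0 < Re (\<Sum>k\<in>UNIV. \<Sum>l\<in>UNIV. v $ k * ?G $ k $ l * cnj (v $ l))" if "v \<noteq> 0" for v
  proof -
    define v' where "v' = (\<chi> k. cnj (v $ k))"
    define u where "u = ?G *v v'"
    have Hu: "H *v u = v'"
      by (simp add: u_def matrix_vector_mul_assoc inv)
    have "v' \<noteq> 0" using that by (simp add: v'_def vec_eq_iff)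
    then have "u \<noteq> 0" using Hu by auto
    then have "(\<chi> k. cnj (u $ k)) \<noteq> 0" by (simp add: vec_eq_iff)
    from posdef_hermitian_pos[OF H this]
    have "0 < Re (\<Sum>k\<in>UNIV. cnj (u $ k) * (H *v u) $ k)"
      by (simp add: matrix_vector_mult_def sum_distrib_left mult.assoc)
    also have "(\<Sum>k\<in>UNIV. cnj (u $ k) * (H *v u) $ k) = cnj (\<Sum>k\<in>UNIV. v $ k * u $ k)"
      unfolding Hu by (simp add: v'_def mult.commute)
    also have "(\<Sum>k\<in>UNIV. v $ k * u $ k) = (\<Sum>k\<in>UNIV. \<Sum>l\<in>UNIV. v $ k * ?G $ k $ l * cnj (v $ l))"
      by (simp add: u_def v'_def matrix_vector_mult_def sum_distrib_left mult.assoc)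
    finally show ?thesis by (simp only: cnj.sel)
  qed
  ultimately show ?thesis unfolding posdef_hermitian_def by blast
qed

text \<open>
  The Gram matrix of the generators is block diagonal: on the \<open>d\<zbar>\<^sub>k\<close> it is twice the inverse of \<open>H\<close>, on
  the \<open>dz\<^sub>k\<close> twice its transpose.
\<close>

lemma covector_minor_pos:
  fixes H :: "'i::{finite,linorder} cmat"
  assumes H: "posdef_hermitian H"
  shows "Im (minor (covector_inner H) S S) = 0" "0 < Re (minor (covector_inner H) S S)"
proof -
  let ?G = "matrix_inv H"
  note G = posdef_hermitian_matrix_inv[OF H]
  have herm: "covector_inner H t s = cnj (covector_inner H s t)" for s t
    by (cases s; cases t; simp) (rule posdef_hermitian_cnj[OF G])+
  have pos: "0 < Re (\<Sum>s\<in>UNIV. \<Sum>t\<in>UNIV. c s * covector_inner H s t * cnj (c t))"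
    if "c \<noteq> (\<lambda>s. 0)" for c
  proof -
    define Q where "Q = (\<lambda>v. Re (\<Sum>k\<in>UNIV. \<Sum>l\<in>UNIV. v $ k * ?G $ k $ l * cnj (v $ l)))"
    define a b where "a = (\<chi> k. cnj (c (Dz k)))" and "b = (\<chi> k. c (Dzb k))"
    have Q: "0 < Q v" if "v \<noteq> 0" for v
      unfolding Q_def using that by (rule posdef_hermitian_pos[OF G])
    have Q': "0 \<le> Q v" for v
      using Q[of v] by (cases "v = 0") (simp_all add: Q_def less_imp_le del: Re_sum)
    have "Re (\<Sum>s\<in>UNIV. \<Sum>t\<in>UNIV. c s * covector_inner H s t * cnj (c t)) = 2 * Q a + 2 * Q b"
    proof -
      have "(\<Sum>k\<in>UNIV. \<Sum>l\<in>UNIV. c (Dz k) * (2 * ?G $ l $ k) * cnj (c (Dz l))) =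
          2 * (\<Sum>k\<in>UNIV. \<Sum>l\<in>UNIV. a $ k * ?G $ k $ l * cnj (a $ l))"
        by (subst sum.swap) (simp add: a_def sum_distrib_left mult_ac)
      moreover have "(\<Sum>k\<in>UNIV. \<Sum>l\<in>UNIV. c (Dzb k) * (2 * ?G $ k $ l) * cnj (c (Dzb l))) =
          2 * (\<Sum>k\<in>UNIV. \<Sum>l\<in>UNIV. b $ k * ?G $ k $ l * cnj (b $ l))"
        by (simp add: b_def sum_distrib_left mult_ac)
      ultimately show ?thesis by (simp add: sum_gen Q_def del: Re_sum)
    qed
    moreover have "a \<noteq> 0 \<or> b \<noteq> 0"
    proof -
      obtain s where "c s \<noteq> 0" using \<open>c \<noteq> (\<lambda>s. 0)\<close> by auto
      then show ?thesis by (cases s) (auto simp: a_def b_def vec_eq_iff)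
    qed
    ultimately show ?thesis using Q[of a] Q[of b] Q'[of a] Q'[of b] by linarith
  qed
  show "Im (minor (covector_inner H) S S) = 0" "0 < Re (minor (covector_inner H) S S)"
    by (rule posdef_minor_pos[OF herm pos]; assumption)+
qed

lemma smooth_covector_inner:
  fixes h :: "'i::finite cspace \<Rightarrow> 'i cmat"
  assumes "\<And>k l. smooth (\<lambda>x. h x $ k $ l)" "\<And>x. det (h x) \<noteq> 0"
  shows "smooth (\<lambda>x. covector_inner (h x) s t)"
  by (cases s; cases t) (auto intro!: smooth_mult smooth_matrix_inv assms)

lemma smooth_form_hodge_star:
  assumes "\<And>k l. smooth (\<lambda>x. h x $ k $ l)" "\<And>x. det (h x) \<noteq> 0" "smooth_form \<beta>"
  shows "smooth_form (hodge_star h \<beta>)"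
proof -
  have "smooth (\<lambda>x. \<beta> x S)" for S using assms(3) by (simp add: smooth_form_def)
  then show ?thesis
    unfolding smooth_form_def hodge_star_def vol_coeff_def
    by (intro allI smooth_mult smooth_sum smooth_cnj smooth_minor smooth_covector_inner smooth_det
        smooth_const assms)
qed

lemma matrix_inv_scale:
  fixes H :: "complex ^ 'a ^ 'a::finite"
  assumes "det H \<noteq> 0" "\<And>k. r k \<noteq> 0"
    and H': "\<And>k l. H $ k $ l = r k * H' $ k $ l * r l"
  shows "matrix_inv H' $ k $ l = r k * matrix_inv H $ k $ l * r l"
proof -
  have "(\<chi> k l. r k * matrix_inv H $ k $ l * r l) ** H' = mat 1"
  proof -
    have "((\<chi> k l. r k * matrix_inv H $ k $ l * r l) ** H') $ k $ l = 
        r k * (matrix_inv H ** H) $ k $ l * inverse (r l)" for k l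
    proof -
      have "r k * matrix_inv H $ k $ j * r j * H' $ j $ l =
          r k * (matrix_inv H $ k $ j * H $ j $ l) * inverse (r l)" for j
        using assms(2)[of l] by (simp add: H')
      then have "((\<chi> k l. r k * matrix_inv H $ k $ l * r l) ** H') $ k $ l =
          (\<Sum>j\<in>UNIV. r k * (matrix_inv H $ k $ j * H $ j $ l) * inverse (r l))"
        unfolding matrix_matrix_mult_def vec_lambda_beta by (rule sum.cong[OF refl])
      then show ?thesis
        by (simp add: matrix_matrix_mult_def sum_distrib_left sum_distrib_right)
    qed
    then show ?thesis
      using assms(2) by (simp add: matrix_inv_inverse[OF assms(1)] vec_eq_iff mat_def)
  qed
  from matrix_inv_eqI[OF this] show ?thesis by simp
qed

fun gen_index :: "'i gen \<Rightarrow> 'i" where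
  "gen_index (Dz k) = k" | "gen_index (Dzb k) = k"

lemma prod_gen_index:
  "(\<Prod>s\<in>Dz ` A. r (gen_index s)) = (\<Prod>k\<in>A. r k)"
  "(\<Prod>s\<in>Dzb ` A. r (gen_index s)) = (\<Prod>k\<in>A. r k)"
  by (simp_all add: prod.reindex inj_on_def)

lemma covector_inner_scale:
  fixes H :: "'i::finite cmat"
  assumes "det H \<noteq> 0" "\<And>k. r k \<noteq> 0"
    and "\<And>k l. H $ k $ l = r k * H' $ k $ l * r l"
  shows "covector_inner H' s t = r (gen_index s) * covector_inner H s t * r (gen_index t)"
  by (cases s; cases t) (simp_all add: matrix_inv_scale[OF assms])

section \<open>Monomial forms and Bott-Chern harmonic forms\<close>

lemma shuffle_sign_nonzero: "shuffle_sign S T \<noteq> 0"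
  by (simp add: shuffle_sign_def)

lemma cnj_shuffle_sign [simp]: "cnj (shuffle_sign S T) = shuffle_sign S T"
  by (simp add: shuffle_sign_def)

lemma wedge_gen_form:
  "wedge (gen_form e) \<beta> x U = (if e \<in> U then shuffle_sign {e} (U - {e}) * \<beta> x (U - {e}) else 0)"
proof -
  have "wedge (gen_form e) \<beta> x U =
      (\<Sum>S\<in>Pow U. if S = {e} then shuffle_sign S (U - S) * \<beta> x (U - S) else 0)"
    unfolding wedge_def gen_form_def by (intro sum.cong) auto
  then show ?thesis by simp
qed

lemma del_eq:
  "del \<alpha> x U = (\<Sum>k\<in>UNIV. if Dz k \<in> U then
     shuffle_sign {Dz k} (U - {Dz k}) * wirtinger (Dz k) (\<lambda>y. \<alpha> y (U - {Dz k})) x else 0)"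
  by (simp add: del_def wedge_gen_form coeff_deriv_def)

lemma delbar_eq:
  "delbar \<alpha> x U = (\<Sum>k\<in>UNIV. if Dzb k \<in> U then
     shuffle_sign {Dzb k} (U - {Dzb k}) * wirtinger (Dzb k) (\<lambda>y. \<alpha> y (U - {Dzb k})) x else 0)"
  by (simp add: delbar_def wedge_gen_form coeff_deriv_def)

lemma wirtinger_zero [simp]: "wirtinger e (\<lambda>x. 0) = (\<lambda>x. 0)"
  by (cases e) (simp_all add: wirtinger.simps)

definition monomial :: "('i cspace \<Rightarrow> complex) \<Rightarrow> 'i gen set \<Rightarrow> 'i form" where
  "monomial \<phi> S = (\<lambda>x T. if T = S then \<phi> x else 0)"

lemma wirtinger_monomial:
  "wirtinger e (\<lambda>y. monomial \<phi> S y T) x = (if T = S then wirtinger e \<phi> x else 0)"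
  by (cases "T = S") (simp_all add: monomial_def cong: if_cong)

lemma del_monomial_eq_0:
  assumes "\<And>k. Dz k \<in> S \<or> wirtinger (Dz k) \<phi> = (\<lambda>x. 0)"
  shows "del (monomial \<phi> S) = (\<lambda>x U. 0)"
proof (intro ext)
  fix x U
  have "wirtinger (Dz k) (\<lambda>y. monomial \<phi> S y (U - {Dz k})) x = 0" for k
    using assms[of k] by (auto simp: wirtinger_monomial)
  then show "del (monomial \<phi> S) x U = 0"
    unfolding del_eq by (intro sum.neutral) auto
qed

lemma delbar_monomial_eq_0:
  assumes "\<And>k. Dzb k \<in> S \<or> wirtinger (Dzb k) \<phi> = (\<lambda>x. 0)"
  shows "delbar (monomial \<phi> S) = (\<lambda>x U. 0)"
proof (intro ext)
  fix x U
  have "wirtinger (Dzb k) (\<lambda>y. monomial \<phi> S y (U - {Dzb k})) x = 0" for k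
    using assms[of k] by (auto simp: wirtinger_monomial)
  then show "delbar (monomial \<phi> S) x U = 0"
    unfolding delbar_eq by (intro sum.neutral) auto
qed

lemma wedge_monomial:
  assumes "S \<inter> T = {}"
  shows "wedge (monomial \<phi> S) (monomial \<psi> T) =
    monomial (\<lambda>x. shuffle_sign S T * \<phi> x * \<psi> x) (S \<union> T)"
proof (intro ext)
  fix x U
  have "wedge (monomial \<phi> S) (monomial \<psi> T) x U =
      (\<Sum>R\<in>Pow U. if R = S then (if U - S = T then shuffle_sign S T * \<phi> x * \<psi> x else 0) else 0)"
    unfolding wedge_def monomial_def by (intro sum.cong) auto
  also have "\<dots> = (if S \<subseteq> U \<and> U - S = T then shuffle_sign S T * \<phi> x * \<psi> x else 0)"
    by simp
  also have "S \<subseteq> U \<and> U - S = T \<longleftrightarrow> U = S \<union> T" using assms by auto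
  finally show "wedge (monomial \<phi> S) (monomial \<psi> T) x U =
      monomial (\<lambda>x. shuffle_sign S T * \<phi> x * \<psi> x) (S \<union> T) x U"
    by (simp add: monomial_def)
qed

lemma smooth_form_monomial:
  assumes "smooth \<phi>"
  shows "smooth_form (monomial \<phi> S)"
proof -
  have "smooth (\<lambda>x. monomial \<phi> S x T)" for T
    using assms by (cases "T = S") (simp_all add: monomial_def)
  then show ?thesis by (simp add: smooth_form_def)
qed

lemma hodge_star_monomial:
  "hodge_star h (monomial \<phi> S) x T =
     shuffle_sign (- T) T * vol_coeff (h x) * cnj (\<phi> x) * minor (covector_inner (h x)) (- T) S"
proof -
  have "(\<Sum>R\<in>UNIV. cnj (monomial \<phi> S x R) * minor (covector_inner (h x)) (- T) R) =
      (\<Sum>R\<in>UNIV. if R = S then cnj (\<phi> x) * minor (covector_inner (h x)) (- T) S else 0)"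
    by (intro sum.cong) (auto simp: monomial_def)
  then show ?thesis by (simp add: hodge_star_def mult.assoc)
qed

text \<open>
  A coefficient of the star of a \<open>(p, 0)\<close>-form vanishes unless its index contains every \<open>d\<zbar>\<^sub>k\<close>, because
  \<open>dz\<^sub>j\<close> and \<open>d\<zbar>\<^sub>k\<close> are orthogonal.  One more factor \<open>d\<zbar>\<^sub>k\<close> therefore gives zero.
\<close>

lemma del_delbar_hodge_star_holomorphic:
  "del (delbar (hodge_star h (monomial \<phi> (Dz ` A)))) = (\<lambda>x U. 0)"
proof -
  have "hodge_star h (monomial \<phi> (Dz ` A)) x T = 0" if "Dzb k \<notin> T" for x T k
  proof -
    have "minor (covector_inner (h x)) (- T) (Dz ` A) = 0"
      using that by (intro minor_eq_0[of "Dzb k"]) auto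
    then show ?thesis by (simp add: hodge_star_monomial)
  qed
  then have "hodge_star h (monomial \<phi> (Dz ` A)) y (U - {Dzb k}) = 0" for y U k by blast
  then have "delbar (hodge_star h (monomial \<phi> (Dz ` A))) = (\<lambda>x U. 0)"
    unfolding delbar_eq by (intro ext sum.neutral) auto
  then show ?thesis unfolding del_eq by (intro ext sum.neutral) auto
qed

text \<open>
  Here it is \<open>del\<close> that meets a form containing every \<open>dz\<^sub>k\<close>.
\<close>

lemma del_delbar_hodge_star_antiholomorphic:
  "del (delbar (hodge_star h (monomial \<phi> (Dzb ` A)))) = (\<lambda>x U. 0)"
proof -
  have 0: "hodge_star h (monomial \<phi> (Dzb ` A)) x T = 0" if "Dz k \<notin> T" for x T k
  proof -
    have "minor (covector_inner (h x)) (- T) (Dzb ` A) = 0"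
      using that by (intro minor_eq_0[of "Dz k"]) auto
    then show ?thesis by (simp add: hodge_star_monomial)
  qed
  have "delbar (hodge_star h (monomial \<phi> (Dzb ` A))) x U = 0" if "Dz k \<notin> U" for x U k
    using that unfolding delbar_eq by (intro sum.neutral) (simp add: 0[of k])
  then have "delbar (hodge_star h (monomial \<phi> (Dzb ` A))) y (U - {Dz k}) = 0" for y U k by blast
  then show ?thesis unfolding del_eq by (intro ext sum.neutral) auto
qed

lemma bc_harmonic_zero:
  fixes h :: "('i::{finite,linorder}) cspace \<Rightarrow> 'i cmat"
  shows "bc_harmonic D h p q (\<lambda>x S. 0)"
proof -
  have "monomial (\<lambda>x. 0) S = (\<lambda>x T. 0)" for S :: "'i gen set"
    by (simp add: monomial_def fun_eq_iff)
  then show ?thesis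
    using del_monomial_eq_0[of "{} :: 'i gen set" "\<lambda>x. 0"]
      delbar_monomial_eq_0[of "{} :: 'i gen set" "\<lambda>x. 0"]
      del_delbar_hodge_star_holomorphic[of h "\<lambda>x. 0" "{}"]
    by (simp add: bc_harmonic_def quotient_form_def smooth_form_def pullback_def has_bidegree_def)
qed

lemma bc_harmonic_in_space:
  fixes \<alpha> :: "('i::{finite,linorder}) form"
  assumes "bc_harmonic D h p q \<alpha>" "p \<le> CARD('i)" "q \<le> CARD('i)"
  shows "\<alpha> \<in> bc_harmonic_space D h"
proof -
  let ?a = "\<lambda>p' q'. if p' = p \<and> q' = q then \<alpha> else (\<lambda>x S. 0)"
  have "\<alpha> x S = (\<Sum>p'\<le>CARD('i). \<Sum>q'\<le>CARD('i). ?a p' q' x S)" for x S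
  proof -
    have "(\<Sum>q'\<le>CARD('i). ?a p' q' x S) = (if p' = p then \<alpha> x S else 0)" for p'
      using assms(3) by (cases "p' = p") (simp_all add: if_distrib[of "\<lambda>f. f x S"] cong: if_cong)
    then show ?thesis using assms(2) by simp
  qed
  then have eq: "\<alpha> = (\<lambda>x S. \<Sum>p'\<le>CARD('i). \<Sum>q'\<le>CARD('i). ?a p' q' x S)" by (intro ext)
  show ?thesis
    unfolding bc_harmonic_space_def
  proof (intro CollectI exI[of _ ?a] conjI allI)
    show "bc_harmonic D h p' q' (?a p' q')" for p' q'
      using assms(1) bc_harmonic_zero by auto
  qed (rule eq)
qed

text \<open>
  Bidegrees are independent, so a sum of harmonic forms that is itself of pure bidegree is equal to its
  component of that bidegree.
\<close>

lemma bc_harmonic_of_space: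
  fixes \<alpha> :: "('i::{finite,linorder}) form"
  assumes "\<alpha> \<in> bc_harmonic_space D h" "has_bidegree p q \<alpha>" "p \<le> CARD('i)" "q \<le> CARD('i)"
  shows "bc_harmonic D h p q \<alpha>"
proof -
  obtain a where a: "\<alpha> = (\<lambda>x S. \<Sum>p\<le>CARD('i). \<Sum>q\<le>CARD('i). a p q x S)"
    "\<And>p q. bc_harmonic D h p q (a p q)"
    using assms(1) unfolding bc_harmonic_space_def by blast
  have bideg: "a p' q' x S = 0" if "card (Dz -` S) \<noteq> p' \<or> card (Dzb -` S) \<noteq> q'" for p' q' x S
    using a(2)[of p' q'] that unfolding bc_harmonic_def has_bidegree_def by blast
  have "\<alpha> x S = a p q x S" for x S
  proof (cases "card (Dz -` S) = p \<and> card (Dzb -` S) = q")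
    case True
    have "(\<Sum>q'\<le>CARD('i). a p' q' x S) = (if p' = p then a p q x S else 0)" for p'
    proof (cases "p' = p")
      case [simp]: True
      have "(\<Sum>q'\<le>CARD('i). a p q' x S) = (\<Sum>q'\<le>CARD('i). if q' = q then a p q x S else 0)"
        using \<open>card (Dz -` S) = p \<and> _\<close> by (intro sum.cong) (auto intro!: bideg)
      then show ?thesis using assms(4) by simp
    next
      case False
      then show ?thesis using True by (simp add: bideg)
    qed
    then show ?thesis using assms(3) by (simp add: a(1))
  next
    case False
    then show ?thesis using assms(2) bideg[of S p q x] unfolding has_bidegree_def by metis
  qed
  then have "\<alpha> = a p q" by (intro ext)
  then show ?thesis using a(2) by simp
qed

section \<open>Averaging differential forms\<close>

lemma wirtinger_eq_lincomb:
  "wirtinger (Dz k) f = (\<lambda>x. 1 / 2 * dir_deriv (axis k 1) f x + (- \<i> / 2) * dir_deriv (axis k \<i>) f x)"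
  "wirtinger (Dzb k) f = (\<lambda>x. 1 / 2 * dir_deriv (axis k 1) f x + (\<i> / 2) * dir_deriv (axis k \<i>) f x)"
  by (simp_all add: wirtinger.simps fun_eq_iff field_simps)

lemma smooth_wirtinger: "smooth f \<Longrightarrow> smooth (wirtinger e f)"
  by (cases e) (auto simp only: wirtinger_eq_lincomb intro!: smooth_add smooth_mult smooth_const smooth_dir_deriv)

lemma wirtinger_avgs:
  assumes "smooth f"
  shows "wirtinger e (foldr avg vs f) = foldr avg vs (wirtinger e f)"
  using assms
  by (cases e) (simp_all only: wirtinger_eq_lincomb avgs_add avgs_mult_left smooth_mult smooth_const
      smooth_dir_deriv dir_deriv_avgs)

lemma dir_deriv_periodic:
  assumes "smooth f" "\<And>x. f (x + p) = f x"
  shows "dir_deriv v f (x + p) = dir_deriv v f x"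
proof -
  have "(f \<circ> (\<lambda>x. x + p) has_derivative (\<lambda>v. dir_deriv v f (x + p)) \<circ> (\<lambda>v. v)) (at x)"
    by (intro diff_chain_at has_derivative_dir_deriv smooth_differentiable assms(1))
      (auto intro!: derivative_eq_intros)
  then have "(f has_derivative (\<lambda>v. dir_deriv v f (x + p))) (at x)"
    by (simp add: o_def assms(2))
  then show ?thesis by (simp add: dir_deriv_eqI)
qed

lemma wirtinger_periodic:
  assumes "smooth f" "\<And>x. f (x + p) = f x"
  shows "wirtinger e f (x + p) = wirtinger e f x"
  by (cases e) (simp_all add: wirtinger.simps dir_deriv_periodic[OF assms])

lemma smooth_if: "(P \<Longrightarrow> smooth f) \<Longrightarrow> smooth (\<lambda>x. if P then f x else 0)"
  by (cases P) auto

lemma smooth_form_delbar: "smooth_form \<alpha> \<Longrightarrow> smooth_form (delbar \<alpha>)"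
  unfolding smooth_form_def delbar_eq
  by (intro allI smooth_sum smooth_if smooth_mult smooth_wirtinger) auto

lemma delbar_periodic:
  assumes "smooth_form \<alpha>" "\<And>x T. \<alpha> (x + p) T = \<alpha> x T"
  shows "delbar \<alpha> (x + p) U = delbar \<alpha> x U"
  unfolding delbar_eq
  using wirtinger_periodic[of "\<lambda>y. \<alpha> y T" p for T] assms by (auto simp: smooth_form_def intro!: sum.cong)

definition avg_form :: "'i::finite cspace list \<Rightarrow> 'i form \<Rightarrow> 'i form" where
  "avg_form vs \<alpha> = (\<lambda>x T. foldr avg vs (\<lambda>y. \<alpha> y T) x)"

lemma avg_form_delbar:
  assumes "smooth_form \<alpha>"
  shows "delbar (avg_form vs \<alpha>) = avg_form vs (delbar \<alpha>)"
proof (intro ext)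
  fix x U
  have sm: "smooth (\<lambda>y. \<alpha> y T)" for T using assms by (simp add: smooth_form_def)
  let ?t = "\<lambda>k x. if Dzb k \<in> U then shuffle_sign {Dzb k} (U - {Dzb k}) *
      wirtinger (Dzb k) (\<lambda>y. \<alpha> y (U - {Dzb k})) x else 0"
  have "smooth (?t k)" for k
    by (intro smooth_if smooth_mult smooth_wirtinger sm smooth_const)
  then have "avg_form vs (delbar \<alpha>) x U = (\<Sum>k\<in>UNIV. foldr avg vs (?t k) x)"
    unfolding avg_form_def delbar_eq by (subst avgs_sum) auto
  also have "\<dots> = delbar (avg_form vs \<alpha>) x U"
    unfolding delbar_eq avg_form_def
    by (intro sum.cong) (auto simp: avgs_mult_left wirtinger_avgs sm)
  finally show "delbar (avg_form vs \<alpha>) x U = avg_form vs (delbar \<alpha>) x U" ..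
qed

lemma avg_form_del:
  assumes "smooth_form \<alpha>"
  shows "del (avg_form vs \<alpha>) = avg_form vs (del \<alpha>)"
proof (intro ext)
  fix x U
  have sm: "smooth (\<lambda>y. \<alpha> y T)" for T using assms by (simp add: smooth_form_def)
  let ?t = "\<lambda>k x. if Dz k \<in> U then shuffle_sign {Dz k} (U - {Dz k}) *
      wirtinger (Dz k) (\<lambda>y. \<alpha> y (U - {Dz k})) x else 0"
  have "smooth (?t k)" for k
    by (intro smooth_if smooth_mult smooth_wirtinger sm smooth_const)
  then have "avg_form vs (del \<alpha>) x U = (\<Sum>k\<in>UNIV. foldr avg vs (?t k) x)"
    unfolding avg_form_def del_eq by (subst avgs_sum) auto
  also have "\<dots> = del (avg_form vs \<alpha>) x U"
    unfolding del_eq avg_form_def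
    by (intro sum.cong) (auto simp: avgs_mult_left wirtinger_avgs sm)
  finally show "del (avg_form vs \<alpha>) x U = avg_form vs (del \<alpha>) x U" ..
qed

text \<open>
  Let the periods span all real directions but that of \<open>Re z\<^bsub>k0\<^esub>\<close>.  In the coefficient of
  \<open>del delbar \<omega> = 0\<close> at \<open>T \<union> {dz\<^bsub>k0\<^esub>, d\<zbar>\<^bsub>k0\<^esub>}\<close>, averaging kills every term that carries a derivative in
  another direction.  Up to sign, what survives is a quarter of the second derivative in
  \<open>Re z\<^bsub>k0\<^esub>\<close> of the averaged coefficient at \<open>T\<close>.
\<close>

lemma averaged_second_derivative:
  fixes \<omega> :: "('i::{finite,linorder}) form"
  assumes sm: "smooth_form \<omega>" and per: "\<And>p x T. p \<in> set vs \<Longrightarrow> \<omega> (x + p) T = \<omega> x T"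
    and span: "\<And>k c. k \<noteq> k0 \<Longrightarrow> axis k c \<in> span (set vs)" "axis k0 \<i> \<in> span (set vs)"
    and 0: "del (delbar \<omega>) = (\<lambda>x U. 0)"
    and T: "Dz k0 \<notin> T" "Dzb k0 \<notin> T"
  defines "f \<equiv> foldr avg vs (\<lambda>x. \<omega> x T)"
  shows "dir_deriv (axis k0 1) (dir_deriv (axis k0 1) f) = (\<lambda>x. 0)"
proof
  fix x
  define \<Omega> where "\<Omega> = avg_form vs \<omega>"
  have van: "wirtinger (Dz k) (\<lambda>y. avg_form vs \<beta> y S) = (\<lambda>x. 0)"
    "wirtinger (Dzb k) (\<lambda>y. avg_form vs \<beta> y S) = (\<lambda>x. 0)"
    if "smooth_form \<beta>" "\<And>p x T. p \<in> set vs \<Longrightarrow> \<beta> (x + p) T = \<beta> x T" "k \<noteq> k0" for \<beta> S k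
  proof -
    have "dir_deriv (axis k c) (foldr avg vs (\<lambda>y. \<beta> y S)) = (\<lambda>x. 0)" for c
      using that by (intro dir_deriv_avgs_span_eq_0 span) (auto simp: smooth_form_def)
    then show "wirtinger (Dz k) (\<lambda>y. avg_form vs \<beta> y S) = (\<lambda>x. 0)"
      "wirtinger (Dzb k) (\<lambda>y. avg_form vs \<beta> y S) = (\<lambda>x. 0)"
      by (simp_all add: wirtinger.simps avg_form_def)
  qed
  have smT: "smooth (\<lambda>y. \<omega> y T)" using sm by (simp add: smooth_form_def)
  let ?U = "T \<union> {Dz k0, Dzb k0}" and ?V = "T \<union> {Dzb k0}"
  have UV: "?U - {Dz k0} = ?V" and VT: "?V - {Dzb k0} = T" using T by auto
  have "delbar \<Omega> y ?V = (\<Sum>k\<in>UNIV. if k = k0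
      then shuffle_sign {Dzb k0} T * wirtinger (Dzb k0) (\<lambda>y. \<Omega> y T) y else 0)" for y
    unfolding delbar_eq
  proof (intro sum.cong refl)
    fix k
    show "(if Dzb k \<in> ?V then shuffle_sign {Dzb k} (?V - {Dzb k}) *
        wirtinger (Dzb k) (\<lambda>y. \<Omega> y (?V - {Dzb k})) y else 0) =
      (if k = k0 then shuffle_sign {Dzb k0} T * wirtinger (Dzb k0) (\<lambda>y. \<Omega> y T) y else 0)"
      using van(2)[OF sm per, of k "?V - {Dzb k}"] VT by (cases "k = k0") (simp_all add: \<Omega>_def)
  qed
  then have delbar: "delbar \<Omega> y ?V = shuffle_sign {Dzb k0} T * wirtinger (Dzb k0) (\<lambda>y. \<Omega> y T) y" for y
    by simp
  have \<Omega>: "delbar \<Omega> = avg_form vs (delbar \<omega>)"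
    unfolding \<Omega>_def by (rule avg_form_delbar[OF sm])
  have "del (delbar \<Omega>) x ?U = (\<Sum>k\<in>UNIV. if k = k0
      then shuffle_sign {Dz k0} ?V * wirtinger (Dz k0) (\<lambda>y. delbar \<Omega> y ?V) x else 0)"
    unfolding del_eq
  proof (intro sum.cong refl)
    fix k
    show "(if Dz k \<in> ?U then shuffle_sign {Dz k} (?U - {Dz k}) *
        wirtinger (Dz k) (\<lambda>y. delbar \<Omega> y (?U - {Dz k})) x else 0) =
      (if k = k0 then shuffle_sign {Dz k0} ?V * wirtinger (Dz k0) (\<lambda>y. delbar \<Omega> y ?V) x else 0)"
    proof (cases "k = k0")
      case True
      then show ?thesis using UV by simp
    next
      case False
      then show ?thesis
        using van(1)[OF smooth_form_delbar[OF sm] delbar_periodic[OF sm per] False, of "?U - {Dz k}"]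
        by (simp add: \<Omega>)
    qed
  qed
  moreover have "del (delbar \<Omega>) x ?U = 0"
    unfolding \<Omega> avg_form_del[OF smooth_form_delbar[OF sm]] 0 by (simp add: avg_form_def)
  ultimately have W: "wirtinger (Dz k0) (\<lambda>y. delbar \<Omega> y ?V) x = 0"
    by (simp add: shuffle_sign_nonzero)
  define c where "c = shuffle_sign {Dzb k0} T / 2"
  have V: "delbar \<Omega> y ?V = c * dir_deriv (axis k0 1) f y" for y
  proof -
    have "dir_deriv (axis k0 \<i>) f = (\<lambda>x. 0)"
      unfolding f_def using smT per by (intro dir_deriv_avgs_span_eq_0 span(2)) auto
    moreover have "(\<lambda>y. \<Omega> y T) = f" by (simp add: \<Omega>_def avg_form_def f_def)
    ultimately show ?thesis
      by (subst delbar) (simp add: wirtinger.simps c_def)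
  qed
  have mixed: "dir_deriv (axis k0 \<i>) (dir_deriv (axis k0 1) f) = (\<lambda>x. 0)"
  proof -
    have "dir_deriv (axis k0 \<i>) (foldr avg vs (dir_deriv (axis k0 1) (\<lambda>y. \<omega> y T))) = (\<lambda>x. 0)"
    proof (intro dir_deriv_avgs_span_eq_0 span(2) smooth_dir_deriv smT)
      show "dir_deriv (axis k0 1) (\<lambda>y. \<omega> y T) (x + p) = dir_deriv (axis k0 1) (\<lambda>y. \<omega> y T) x"
        if "p \<in> set vs" for p x
        using per[OF that] by (intro dir_deriv_periodic smT)
    qed
    then show ?thesis by (simp add: f_def dir_deriv_avgs smT)
  qed
  have "smooth (dir_deriv (axis k0 1) f)"
    unfolding f_def by (intro smooth_dir_deriv smooth_avgs smT)
  moreover have "c \<noteq> 0" by (simp add: c_def shuffle_sign_nonzero)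
  ultimately show "dir_deriv (axis k0 1) (dir_deriv (axis k0 1) f) x = 0"
    using W unfolding V by (simp add: wirtinger.simps dir_deriv_mult_left mixed)
qed

section \<open>Translations of the generalized Nakamura manifold\<close>

text \<open>
  Left translation by \<open>(a, b)\<close> is affine with linear part \<open>diag (1, \<rho>(a))\<close>; \<open>stretch\<close> lists the diagonal
  entries.  They depend on \<open>Re a\<close> only.
\<close>

definition stretch :: "('n \<Rightarrow> real) \<Rightarrow> complex \<Rightarrow> 'n option \<Rightarrow> complex" where
  "stretch lam a k = (case k of None \<Rightarrow> 1 | Some i \<Rightarrow> of_real (exp (lam i * Re a)))"

lemma stretch_simps [simp]:
  "stretch lam a None = 1"
  "stretch lam a (Some i) = of_real (exp (lam i * Re a))"
  by (simp_all add: stretch_def)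

lemma cnj_stretch [simp]: "cnj (stretch lam a k) = stretch lam a k"
  by (cases k) simp_all

lemma stretch_nonzero [simp]: "stretch lam a k \<noteq> 0"
  by (cases k) simp_all

lemma nak_mult_component:
  "nak_mult lam g x $ k = g $ k + stretch lam (g $ None) k * x $ k"
proof (cases k)
  case (Some i)
  have "exp (1 / 2 * of_real (lam i) * (g $ None + cnj (g $ None))) =
      complex_of_real (exp (lam i * Re (g $ None)))"
    by (simp add: complex_add_cnj exp_of_real[symmetric] mult.commute)
  then show ?thesis
    using Some
    by (simp add: nak_mult_def point_def w_part_def z_part_def rho_def matrix_vector_mult_def
        if_distrib[of "\<lambda>u. u * _"] cong: if_cong)
qed (simp add: nak_mult_def point_def w_part_def)

lemma dir_deriv_coord_nak_mult:
  "dir_deriv v (\<lambda>y. coord s (nak_mult lam g y)) x = stretch lam (g $ None) (gen_index s) * coord s v"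
proof (rule dir_deriv_eqI, cases s)
  case (Dz k)
  then show "((\<lambda>y. coord s (nak_mult lam g y)) has_derivative
      (\<lambda>v. stretch lam (g $ None) (gen_index s) * coord s v)) (at x)"
    by (auto simp: nak_mult_component intro!: derivative_eq_intros
        bounded_linear_imp_has_derivative[OF bounded_linear_vec_nth])
next
  case (Dzb k)
  then show "((\<lambda>y. coord s (nak_mult lam g y)) has_derivative
      (\<lambda>v. stretch lam (g $ None) (gen_index s) * coord s v)) (at x)"
    by (auto simp: nak_mult_component intro!: derivative_eq_intros
        bounded_linear_imp_has_derivative[OF bounded_linear_vec_nth])
qed

lemma jacobian_nak_mult:
  "jacobian (nak_mult lam g) x s t = (if s = t then stretch lam (g $ None) (gen_index s) else 0)"
  unfolding jacobian_def
  by (cases t; simp only: wirtinger.simps dir_deriv_coord_nak_mult; cases s) (auto simp: axis_def complex_eq_iff)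

lemma pullback_nak_mult:
  "pullback (nak_mult lam g) \<alpha> x T =
     \<alpha> (nak_mult lam g x) T * (\<Prod>s\<in>T. stretch lam (g $ None) (gen_index s))"
proof -
  have "minor (jacobian (nak_mult lam g) x) S T =
      (if S = T then \<Prod>s\<in>T. stretch lam (g $ None) (gen_index s) else 0)" for S
    by (subst minor_diagonal) (auto simp: jacobian_nak_mult)
  then show ?thesis
    by (simp add: pullback_def if_distrib[of "\<lambda>u. _ * u"] cong: if_cong)
qed

lemma hermitian_metric_posdef: "hermitian_metric D h \<Longrightarrow> posdef_hermitian (h x)"
  unfolding hermitian_metric_def posdef_hermitian_def by blast

lemma hermitian_metric_smooth: "hermitian_metric D h \<Longrightarrow> smooth (\<lambda>x. h x $ k $ l)"
  unfolding hermitian_metric_def by blast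

lemma hermitian_metric_nak_mult:
  assumes "hermitian_metric (nak_deck P lam \<tau>) h" "g \<in> nak_lattice P \<tau>"
  shows "h x $ k $ l =
    stretch lam (g $ None) k * h (nak_mult lam g x) $ k $ l * stretch lam (g $ None) l"
proof -
  let ?F = "nak_mult lam g"
  have "?F \<in> nak_deck P lam \<tau>" using assms(2) by (simp add: nak_deck_def)
  then have "h x $ k $ l = (\<Sum>a\<in>UNIV. \<Sum>b\<in>UNIV. jacobian ?F x (Dz a) (Dz k) * h (?F x) $ a $ b
      * cnj (jacobian ?F x (Dz b) (Dz l)))"
    using assms(1) unfolding hermitian_metric_def by blast
  also have "\<dots> = (\<Sum>a\<in>UNIV. \<Sum>b\<in>UNIV. if b = l then if a = k then
      stretch lam (g $ None) k * h (?F x) $ k $ l * stretch lam (g $ None) l else 0 else 0)"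
    by (intro sum.cong) (auto simp: jacobian_nak_mult)
  finally show ?thesis by simp
qed

lemma det_map_matrix_of_int: "det (map_matrix real_of_int M) = real_of_int (det M)"
  by (simp add: det_def map_matrix_def)

lemma nakamura_sum_lam_eq_0:
  assumes "nakamura_data M P lam \<tau>"
  shows "(\<Sum>i\<in>UNIV. lam i) = 0"
proof -
  have "invertible P" using assms by (simp add: nakamura_data_def)
  then have "\<exists>Q. P ** Q = mat 1 \<and> Q ** P = mat 1" by (simp add: invertible_def)
  then have P: "P ** matrix_inv P = mat 1"
    unfolding matrix_inv_def by (rule someI2_ex) simp
  have "exp (\<Sum>i\<in>UNIV. lam i) = det (\<chi> i j. if i = j then exp (lam i) else 0)"
    by (subst det_diagonal) (simp_all add: exp_sum)
  also have "\<dots> = det (P ** map_matrix real_of_int M ** matrix_inv P)"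
    using assms unfolding nakamura_data_def by simp
  also have "\<dots> = det (P ** matrix_inv P)"
  proof -
    have "det M = 1" using assms by (simp add: nakamura_data_def)
    then show ?thesis by (simp add: det_mul det_map_matrix_of_int)
  qed
  finally show ?thesis unfolding P by simp
qed

lemma lattice1_int: "of_int m \<in> lattice1 \<tau>"
  unfolding lattice1_def by (intro CollectI exI[of _ m] exI[of _ 0]) simp

lemma lattice2_I:
  "map_matrix of_real P *v ((\<chi> i. of_int (u $ i)) + (\<chi> i. \<i> * of_int (v $ i))) \<in> lattice2 P"
  unfolding lattice2_def by blast

lemma lattice2_zero: "0 \<in> lattice2 P"
proof -
  have "(\<chi> i. of_int ((0 :: int ^ 'a) $ i)) + (\<chi> i. \<i> * of_int ((0 :: int ^ 'a) $ i)) = 0"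
    by (simp add: vec_eq_iff)
  then show ?thesis using lattice2_I[of P 0 0] by (simp only: matrix_vector_mult_0_right)
qed

lemma point_None [simp]: "point a b $ None = a" and point_Some [simp]: "point a b $ Some i = b $ i"
  by (simp_all add: point_def)

lemma nak_mult_translation:
  assumes "Re (p $ None) = 0"
  shows "nak_mult lam p x = x + p"
  unfolding vec_eq_iff nak_mult_component
proof
  show "p $ k + stretch lam (p $ None) k * x $ k = (x + p) $ k" for k
    using assms by (cases k) simp_all
qed

lemma complex_vec_real_expansion:
  fixes y :: "complex ^ 'n::finite"
  shows "y = (\<Sum>j\<in>UNIV. Re (y $ j) *\<^sub>R axis j 1 + Im (y $ j) *\<^sub>R axis j \<i>)"
proof -
  have "(\<Sum>j\<in>UNIV. Re (y $ j) *\<^sub>R axis j 1 + Im (y $ j) *\<^sub>R axis j \<i>) $ i =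
      (\<Sum>j\<in>UNIV. if j = i then y $ i else 0)" for i
    unfolding sum_component by (intro sum.cong) (auto simp: axis_def complex_eq_iff)
  then show ?thesis by (simp add: vec_eq_iff)
qed


lemma nak_lattice_I: "a \<in> lattice1 \<tau> \<Longrightarrow> b \<in> lattice2 P \<Longrightarrow> point a b \<in> nak_lattice P \<tau>"
  unfolding nak_lattice_def by blast

lemma lattice1_imaginary: "\<i> * of_real \<tau> * of_int m \<in> lattice1 \<tau>"
  unfolding lattice1_def by (intro CollectI exI[of _ 0] exI[of _ m]) simp

lemma lattice1_zero: "0 \<in> lattice1 \<tau>"
  using lattice1_int[of 0] by simp

lemma map_matrix_of_real_inverse:
  assumes "P ** Q = mat 1"
  shows "map_matrix complex_of_real P ** map_matrix complex_of_real Q = mat 1"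
proof -
  have "map_matrix complex_of_real P ** map_matrix complex_of_real Q =
      map_matrix complex_of_real (P ** Q)"
    by (simp add: vec_eq_iff matrix_matrix_mult_def)
  then show ?thesis by (simp add: assms vec_eq_iff mat_def)
qed

text \<open>
  Modulo the lattice points over the imaginary axis, the hyperplane \<open>Re w = 0\<close> is a torus, the image of
  a compact box.
\<close>

lemma periodic_bounded_on_fibre:
  fixes G :: "complex ^ 'n::finite option \<Rightarrow> complex" and P :: "real ^ 'n ^ 'n"
  assumes P: "invertible P" and \<tau>: "\<tau> \<noteq> 0" and cont: "continuous_on UNIV G"
    and per: "\<And>p x. p \<in> nak_lattice P \<tau> \<Longrightarrow> Re (p $ None) = 0 \<Longrightarrow> G (x + p) = G x"
  shows "\<exists>C. \<forall>x. Re (x $ None) = 0 \<longrightarrow> norm (G x) \<le> C"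
proof -
  let ?P = "map_matrix complex_of_real P"
  obtain Q where Q: "P ** Q = mat 1" using P by (auto simp: invertible_def)
  let ?Q = "map_matrix complex_of_real Q"
  note PQ = map_matrix_of_real_inverse[OF Q]
  define \<Phi> where "\<Phi> = (\<lambda>(s :: real, u :: real ^ 'n, v :: real ^ 'n).
    point (\<i> * of_real \<tau> * of_real s) (?P *v (\<chi> i. of_real (u $ i) + \<i> * of_real (v $ i))))"
  define B where "B = {0..1::real} \<times> cbox (0 :: real ^ 'n) 1 \<times> cbox (0 :: real ^ 'n) 1"
  have "continuous_on B (\<lambda>x. \<Phi> x $ k)" for k
    by (cases k) (auto simp: \<Phi>_def case_prod_beta matrix_vector_mult_def intro!: continuous_intros)
  then have "continuous_on B (\<lambda>x. \<chi> k. \<Phi> x $ k)" by (rule continuous_on_vec_lambda)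
  then have "continuous_on B \<Phi>" by simp
  moreover have "compact B" unfolding B_def by (intro compact_Times compact_cbox compact_Icc)
  ultimately have "compact (G ` \<Phi> ` B)"
    by (intro compact_continuous_image continuous_on_subset[OF cont]) auto
  then have "bounded (G ` \<Phi> ` B)" by (rule compact_imp_bounded)
  then obtain C where C: "norm (G (\<Phi> b)) \<le> C" if "b \<in> B" for b
    unfolding bounded_iff by auto
  have "norm (G x) \<le> C" if x: "Re (x $ None) = 0" for x
  proof -
    define s where "s = Im (x $ None) / \<tau>"
    define y where "y = ?Q *v (\<chi> i. x $ Some i)"
    define b where "b = (frac s, (\<chi> i. frac (Re (y $ i))) :: real ^ 'n, (\<chi> i. frac (Im (y $ i))) :: real ^ 'n)"
    define p where "p = point (\<i> * of_real \<tau> * of_int \<lfloor>s\<rfloor>)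
      (?P *v ((\<chi> i. of_int ((\<chi> i. \<lfloor>Re (y $ i)\<rfloor>) $ i)) + (\<chi> i. \<i> * of_int ((\<chi> i. \<lfloor>Im (y $ i)\<rfloor>) $ i))))"
    have b: "b \<in> B"
      by (auto simp: b_def B_def mem_box_cart frac_lt_1 less_imp_le)
    have "x = \<Phi> b + p"
      unfolding vec_eq_iff
    proof
      fix k
      show "x $ k = (\<Phi> b + p) $ k"
      proof (cases k)
        case None
        then show ?thesis
          using x \<tau> by (simp add: \<Phi>_def b_def p_def complex_eq_iff s_def frac_def field_simps)
      next
        case (Some i)
        let ?r = "\<chi> i. of_real (frac (Re (y $ i))) + \<i> * of_real (frac (Im (y $ i)))"
          and ?n = "(\<chi> i. of_int \<lfloor>Re (y $ i)\<rfloor>) + (\<chi> i. \<i> * of_int \<lfloor>Im (y $ i)\<rfloor>)"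
        have ry: "?r + ?n = y"
          by (simp add: vec_eq_iff complex_eq_iff frac_def)
        have "?P *v y = ?P *v ?r + ?P *v ?n"
          by (rule matrix_vector_right_distrib[of ?P ?r ?n, unfolded ry])
        then have "(\<Phi> b + p) $ k = (?P *v y) $ i"
          by (simp add: Some \<Phi>_def b_def p_def)
        also have "\<dots> = x $ k"
          by (simp add: y_def matrix_vector_mul_assoc PQ Some)
        finally show ?thesis ..
      qed
    qed
    moreover have "p \<in> nak_lattice P \<tau>"
      unfolding p_def by (intro nak_lattice_I lattice1_imaginary lattice2_I)
    moreover have "Re (p $ None) = 0" by (simp add: p_def)
    ultimately have "G x = G (\<Phi> b)" by (simp add: per)
    then show ?thesis using C[OF b] by simp
  qed
  then show ?thesis by blast
qed

text \<open>
  The periods \<open>\<i>\<tau>\<close> of \<open>w\<close> and \<open>P e\<^sub>j\<close>, \<open>\<i> P e\<^sub>j\<close> of \<open>z\<close> form a real basis of the hyperplane \<open>Re w = 0\<close>.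
\<close>

lemma fibre_lattice_spans:
  fixes P :: "real ^ 'n ^ 'n::finite"
  assumes P: "invertible P" and \<tau>: "\<tau> \<noteq> 0"
  obtains vs where "\<And>v. v \<in> set vs \<Longrightarrow> v \<in> nak_lattice P \<tau> \<and> Re (v $ None) = 0"
    and "\<And>i c. axis (Some i) c \<in> span (set vs)" and "axis None \<i> \<in> span (set vs)"
proof -
  let ?P = "map_matrix complex_of_real P"
  obtain Q where Q: "P ** Q = mat 1" using P by (auto simp: invertible_def)
  let ?Q = "map_matrix complex_of_real Q"
  note PQ = map_matrix_of_real_inverse[OF Q]
  define V where "V = insert (point (\<i> * of_real \<tau>) 0)
    (range (\<lambda>j. point 0 (?P *v axis j 1)) \<union> range (\<lambda>j. point 0 (?P *v axis j \<i>)))"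
  have "finite V" by (simp add: V_def)
  then obtain vs where vs: "set vs = V" using finite_list by blast
  have lat: "v \<in> nak_lattice P \<tau> \<and> Re (v $ None) = 0" if "v \<in> V" for v
  proof -
    have 1: "(\<chi> i. of_int ((axis j 1 :: int ^ 'n) $ i)) + (\<chi> i. \<i> * of_int ((0 :: int ^ 'n) $ i)) = axis j 1"
      and 2: "(\<chi> i. of_int ((0 :: int ^ 'n) $ i)) + (\<chi> i. \<i> * of_int ((axis j 1 :: int ^ 'n) $ i)) = axis j \<i>" for j
      by (simp_all add: vec_eq_iff axis_def)
    have "?P *v axis j 1 \<in> lattice2 P" "?P *v axis j \<i> \<in> lattice2 P" for j
      using lattice2_I[of P "axis j 1" 0] lattice2_I[of P 0 "axis j 1"] unfolding 1 2 by auto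
    moreover have "\<i> * of_real \<tau> \<in> lattice1 \<tau>" using lattice1_imaginary[of \<tau> 1] by simp
    ultimately show ?thesis
      using that by (auto simp: V_def intro!: nak_lattice_I lattice1_zero lattice2_zero)
  qed
  have z: "point 0 z \<in> span V" for z
  proof -
    define y where "y = ?Q *v z"
    have lin: "linear (\<lambda>y. point 0 (?P *v y))"
      by (rule linearI; simp add: vec_eq_iff point_def matrix_vector_mult_def scaleR_sum_right
          distrib_left sum.distrib split: option.split)
    have "z = ?P *v y" by (simp add: y_def matrix_vector_mul_assoc PQ)
    then have "point 0 z = point 0 (?P *v (\<Sum>j\<in>UNIV. Re (y $ j) *\<^sub>R axis j 1 + Im (y $ j) *\<^sub>R axis j \<i>))"
      using complex_vec_real_expansion[of y] by simp
    also have "\<dots> = (\<Sum>j\<in>UNIV. Re (y $ j) *\<^sub>R point 0 (?P *v axis j 1) + Im (y $ j) *\<^sub>R point 0 (?P *v axis j \<i>))"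
      by (simp only: linear_sum[OF lin] linear_add[OF lin] linear_cmul[OF lin])
    also have "\<dots> \<in> span V"
      by (intro span_sum span_add span_mul span_base) (auto simp: V_def)
    finally show ?thesis .
  qed
  show ?thesis
  proof (rule that[of vs])
    show "axis (Some i) c \<in> span (set vs)" for i c
    proof -
      have "axis (Some i) c = point 0 (axis i c)"
        by (auto simp: vec_eq_iff point_def axis_def split: option.split)
      then show ?thesis using z vs by simp
    qed
    have eq: "axis None \<i> = (1 / \<tau>) *\<^sub>R point (\<i> * of_real \<tau>) (0 :: complex ^ 'n)"
      using \<tau> by (auto simp: vec_eq_iff point_def axis_def complex_eq_iff split: option.split)
    show "axis None \<i> \<in> span (set vs)"
      unfolding eq vs V_def by (intro span_mul span_base insertI1)
  qed (use lat vs in auto)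
qed

text \<open>
  For \<open>k\<close> tending to infinity in the direction where the bound decays, the affine sequence tends to \<open>0\<close>;
  then so do its constant differences.
\<close>

lemma affine_decay_imp_zero:
  fixes a d :: complex
  assumes bound: "\<And>k :: int. norm (a + of_int k * d) \<le> C * exp (\<mu> * of_int k)" and "\<mu> \<noteq> 0"
  shows "a = 0"
proof -
  \<comment> \<open>the direction in which the bound decays\<close>
  define e :: int where "e = (if \<mu> > 0 then - 1 else 1)"
  have e: "\<mu> * of_int e = - \<bar>\<mu>\<bar>" by (simp add: e_def)
  have le: "norm (a + of_nat n * (of_int e * d)) \<le> C * exp (- \<bar>\<mu>\<bar>) ^ n" for n
  proof -
    have "\<mu> * of_int (int n * e) = of_nat n * (\<mu> * of_int e)" by simp
    then have "\<mu> * of_int (int n * e) = of_nat n * (- \<bar>\<mu>\<bar>)" unfolding e .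
    then have "exp (\<mu> * of_int (int n * e)) = exp (- \<bar>\<mu>\<bar>) ^ n"
      by (simp only: exp_of_nat_mult)
    then show ?thesis using bound[of "int n * e"] by (simp add: mult.assoc)
  qed
  have "(\<lambda>n. C * exp (- \<bar>\<mu>\<bar>) ^ n) \<longlonglongrightarrow> C * 0"
    using assms(2) by (intro tendsto_mult tendsto_const LIMSEQ_power_zero) simp
  then have decay: "(\<lambda>n. C * exp (- \<bar>\<mu>\<bar>) ^ n) \<longlonglongrightarrow> 0" by simp
  have lim: "(\<lambda>n. a + of_nat n * (of_int e * d)) \<longlonglongrightarrow> 0"
    by (rule Lim_null_comparison[OF always_eventually decay]) (use le in blast)
  have "(\<lambda>n. (a + of_nat (Suc n) * (of_int e * d)) - (a + of_nat n * (of_int e * d))) \<longlonglongrightarrow> 0 - 0"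
    by (rule tendsto_diff[OF LIMSEQ_Suc[OF lim] lim])
  then have "(\<lambda>n. of_int e * d) \<longlonglongrightarrow> 0"
    by (simp add: algebra_simps)
  then have "of_int e * d = 0" by (simp add: LIMSEQ_const_iff)
  with lim show "a = 0" by (simp add: LIMSEQ_const_iff)
qed

text \<open>
  The fibre average of \<open>g\<close> is positive and affine in \<open>Re w\<close>, but at \<open>Re w = k\<close> it is bounded by a
  multiple of \<open>exp (\<mu> k)\<close>.
\<close>

lemma no_multiplicative_pluriharmonic_coefficient:
  fixes \<omega> :: "('n::{finite,linorder} option) form" and g :: "'n option cspace \<Rightarrow> real"
  assumes P: "invertible P" and \<tau>: "\<tau> \<noteq> 0"
    and sm: "smooth_form \<omega>" and closed: "del (delbar \<omega>) = (\<lambda>x U. 0)"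
    and per: "\<And>p x T. p \<in> nak_lattice P \<tau> \<Longrightarrow> Re (p $ None) = 0 \<Longrightarrow> \<omega> (x + p) T = \<omega> x T"
    and T: "Dz None \<notin> T" "Dzb None \<notin> T"
    and \<omega>: "\<And>x. \<omega> x T = \<kappa> * of_real (g x)" and \<kappa>: "\<kappa> \<noteq> 0" and pos: "\<And>x. 0 < g x"
    and scale: "\<And>k x. g (nak_mult lam (point (of_int k) 0) x) = exp (\<mu> * of_int k) * g x"
    and \<mu>: "\<mu> \<noteq> 0"
  shows False
proof -
  define G where "G = (\<lambda>x. complex_of_real (g x))"
  have smT: "smooth (\<lambda>x. \<omega> x T)" using sm by (simp add: smooth_form_def)
  have G: "G = (\<lambda>x. inverse \<kappa> * \<omega> x T)" using \<kappa> by (simp add: G_def \<omega> fun_eq_iff)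
  have smG: "smooth G" unfolding G by (intro smooth_mult smooth_const smT)
  have perG: "G (x + p) = G x" if "p \<in> nak_lattice P \<tau>" "Re (p $ None) = 0" for p x
    unfolding G using per[OF that] by simp
  obtain C where C: "\<And>x. Re (x $ None) = 0 \<Longrightarrow> norm (G x) \<le> C"
    using periodic_bounded_on_fibre[OF P \<tau> smooth_continuous_on[OF smG] perG] by blast
  obtain vs where vs: "\<And>v. v \<in> set vs \<Longrightarrow> v \<in> nak_lattice P \<tau> \<and> Re (v $ None) = 0"
    and span: "\<And>i c. axis (Some i) c \<in> span (set vs)" "axis None \<i> \<in> span (set vs)"
    using fibre_lattice_spans[OF P \<tau>] by blast
  define f where "f = foldr avg vs G"
  have "dir_deriv (axis None 1) (dir_deriv (axis None 1) f) = (\<lambda>x. 0)"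
  proof -
    let ?F = "foldr avg vs (\<lambda>x. \<omega> x T)"
    have "dir_deriv (axis None 1) (dir_deriv (axis None 1) ?F) = (\<lambda>x. 0)"
    proof (rule averaged_second_derivative[OF sm _ _ span(2) closed T])
      show "axis k c \<in> span (set vs)" if "k \<noteq> None" for k c
        using that span(1) by (cases k) auto
    qed (use per vs in blast)
    moreover have "f = (\<lambda>x. inverse \<kappa> * ?F x)"
      unfolding f_def G by (rule avgs_mult_left)
    ultimately show ?thesis
      by (simp add: dir_deriv_mult_left smooth_avgs smooth_dir_deriv smT)
  qed
  then have affine: "f (0 + t *\<^sub>R axis None 1) = f 0 + of_real t * dir_deriv (axis None 1) f 0" for t
    by (intro affine_along_line) (simp add: f_def smooth_avgs smG)
  have "norm (f 0 + of_int k * dir_deriv (axis None 1) f 0) \<le> C * exp (\<mu> * of_int k)" for k :: int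
  proof -
    have "norm (f (of_int k *\<^sub>R axis None 1)) \<le> C * exp (\<mu> * of_int k)"
      unfolding f_def
    proof (rule norm_avgs_le[OF smG])
      fix x :: "complex ^ 'n option"
      assume "x \<in> {x. Re (x $ None) = of_int k}"
      then have x: "Re (x $ None) = of_int k" by simp
      \<comment> \<open>the preimage of \<open>x\<close> under the translation by \<open>k\<close>, which lies over \<open>Re w = 0\<close>\<close>
      define y where "y = (\<chi> j. (x $ j - point (of_int k) 0 $ j) / stretch lam (of_int k) j)"
      have "nak_mult lam (point (of_int k) 0) y = x"
        by (simp add: vec_eq_iff nak_mult_component y_def)
      then have "g x = exp (\<mu> * of_int k) * g y" using scale[of k y] by simp
      moreover have "norm (G y) \<le> C" by (rule C) (simp add: y_def x)
      ultimately show "norm (G x) \<le> C * exp (\<mu> * of_int k)"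
        by (simp add: G_def norm_mult mult.commute)
    next
      fix x v :: "complex ^ 'n option" and t :: real
      assume "x \<in> {x. Re (x $ None) = of_int k}" "v \<in> set vs"
      then show "x + t *\<^sub>R v \<in> {x. Re (x $ None) = of_int k}" using vs[of v] by simp
    qed (simp add: axis_def)
    then show ?thesis using affine[of "of_int k"] by simp
  qed
  then have "f 0 = 0" using \<mu> by (rule affine_decay_imp_zero)
  moreover have "0 < Re (f 0)"
    unfolding f_def using pos by (intro Re_avgs_pos smG) (simp add: G_def)
  ultimately show False by simp
qed

section \<open>Resonant characters\<close>

lemma smooth_character:
  "smooth (\<lambda>x. exp (- of_real c * x $ k))"
  "smooth (\<lambda>x. exp (- of_real c * cnj (x $ k)))"
  by (intro smooth_exp_linear bounded_linear_const_mult bounded_linear_vec_nth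
      bounded_linear_compose[OF bounded_linear_cnj])+

lemma wirtinger_character:
  "wirtinger e (\<lambda>x. exp (- of_real c * x $ k)) =
    (\<lambda>x. if e = Dz k then - of_real c * exp (- of_real c * x $ k) else 0)"
  "wirtinger e (\<lambda>x. exp (- of_real c * cnj (x $ k))) =
    (\<lambda>x. if e = Dzb k then - of_real c * exp (- of_real c * cnj (x $ k)) else 0)"
proof -
  have 1: "dir_deriv v (\<lambda>x. exp (- of_real c * x $ k)) x = v $ k * (- of_real c * exp (- of_real c * x $ k))" for v x
    by (rule trans[OF dir_deriv_eqI[OF has_derivative_exp_linear[OF
          bounded_linear_const_mult[OF bounded_linear_vec_nth]]]]) (simp add: mult_ac)
  have 2: "dir_deriv v (\<lambda>x. exp (- of_real c * cnj (x $ k))) x =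
      cnj (v $ k) * (- of_real c * exp (- of_real c * cnj (x $ k)))" for v x
    by (rule trans[OF dir_deriv_eqI[OF has_derivative_exp_linear[OF bounded_linear_const_mult[OF
          bounded_linear_compose[OF bounded_linear_cnj bounded_linear_vec_nth]]]]]) (simp add: mult_ac)
  show "wirtinger e (\<lambda>x. exp (- of_real c * x $ k)) =
    (\<lambda>x. if e = Dz k then - of_real c * exp (- of_real c * x $ k) else 0)"
    by (cases e; simp only: wirtinger.simps 1) (auto simp: axis_def fun_eq_iff)
  show "wirtinger e (\<lambda>x. exp (- of_real c * cnj (x $ k))) =
    (\<lambda>x. if e = Dzb k then - of_real c * exp (- of_real c * cnj (x $ k)) else 0)"
    by (cases e; simp only: wirtinger.simps 2) (auto simp: axis_def fun_eq_iff)
qed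

text \<open>
  With \<open>a = k + \<i>\<tau>l\<close> the first product is \<open>exp (-\<i>c\<tau>l)\<close>: the real parts cancel, and resonance takes care
  of the imaginary part.  The second product is its conjugate.
\<close>

lemma resonant_character:
  assumes "a \<in> lattice1 \<tau>" "\<tau> * c = 2 * pi * of_int m"
  shows "exp (- of_real c * a) * of_real (exp (c * Re a)) = 1"
    "exp (- of_real c * cnj a) * of_real (exp (c * Re a)) = 1"
proof -
  obtain k l where a: "a = of_int k + \<i> * of_real \<tau> * of_int l"
    using assms(1) unfolding lattice1_def by blast
  have "exp (- of_real c * a) * of_real (exp (c * Re a)) = exp (- of_real c * a + of_real (c * Re a))"
    by (simp only: exp_add exp_of_real)
  also have "- of_real c * a + of_real (c * Re a) = - (\<i> * of_real (\<tau> * c) * of_int l)"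
    by (simp add: a algebra_simps)
  also have "\<dots> = 2 * of_int (- m * l) * pi * \<i>"
    unfolding assms(2) by simp
  also have "exp \<dots> = 1" by (rule exp_integer_2pi) simp
  finally show 1: "exp (- of_real c * a) * of_real (exp (c * Re a)) = 1" .
  show "exp (- of_real c * cnj a) * of_real (exp (c * Re a)) = 1"
    using arg_cong[OF 1, of cnj] by (simp add: exp_cnj)
qed

lemma prod_stretch:
  fixes K :: "'n::finite set"
  shows "(\<Prod>k\<in>insert None (Some ` K). stretch lam a k) = of_real (exp ((\<Sum>i\<in>K. lam i) * Re a))"
  by (subst prod.insert) (auto simp: prod.reindex exp_sum sum_distrib_right)

text \<open>
  The factor \<open>exp (c Re a)\<close> in \<open>resonant_character\<close> is the product of the stretching factors of
  \<open>dw \<and> dz\<^sub>K\<close>, so both forms are invariant under the deck transformations.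
\<close>

lemma bc_harmonic_character:
  fixes lam :: "'n::{finite,linorder} \<Rightarrow> real" and K :: "'n set"
  defines "c \<equiv> \<Sum>i\<in>K. lam i" and "A \<equiv> insert None (Some ` K)"
  assumes res: "\<tau> * c = 2 * pi * of_int m"
  shows "bc_harmonic (nak_deck P lam \<tau>) h (card A) 0
      (monomial (\<lambda>x. exp (- of_real c * x $ None)) (Dz ` A))"
    and "bc_harmonic (nak_deck P lam \<tau>) h 0 (card A)
      (monomial (\<lambda>x. exp (- of_real c * cnj (x $ None))) (Dzb ` A))"
proof -
  let ?\<phi> = "\<lambda>x :: 'n option cspace. exp (- of_real c * x $ None)"
  let ?\<psi> = "\<lambda>x :: 'n option cspace. exp (- of_real c * cnj (x $ None))"
  have inv: "pullback F (monomial ?\<phi> (Dz ` A)) = monomial ?\<phi> (Dz ` A)"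
    "pullback F (monomial ?\<psi> (Dzb ` A)) = monomial ?\<psi> (Dzb ` A)"
    if "F \<in> nak_deck P lam \<tau>" for F
  proof -
    obtain a b where F: "F = nak_mult lam (point a b)" and a: "a \<in> lattice1 \<tau>"
      using \<open>F \<in> _\<close> unfolding nak_deck_def nak_lattice_def by blast
    have prod: "(\<Prod>s\<in>Dz ` A. stretch lam a (gen_index s)) = of_real (exp (c * Re a))"
      "(\<Prod>s\<in>Dzb ` A. stretch lam a (gen_index s)) = of_real (exp (c * Re a))"
      unfolding prod_gen_index A_def c_def by (rule prod_stretch)+
    show "pullback F (monomial ?\<phi> (Dz ` A)) = monomial ?\<phi> (Dz ` A)"
    proof (intro ext)
      fix x :: "'n option cspace" and T
      have "exp (- of_real c * (a + x $ None)) * of_real (exp (c * Re a)) =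
          exp (- of_real c * x $ None) * (exp (- of_real c * a) * of_real (exp (c * Re a)))"
        by (simp only: complex_cnj_add distrib_left exp_add mult_ac)
      then have "exp (- of_real c * (a + x $ None)) * of_real (exp (c * Re a)) = ?\<phi> x"
        unfolding resonant_character(1)[OF a res] by simp
      then show "pullback F (monomial ?\<phi> (Dz ` A)) x T = monomial ?\<phi> (Dz ` A) x T"
        by (cases "T = Dz ` A") (simp_all add: F pullback_nak_mult monomial_def prod nak_mult_component)
    qed
    show "pullback F (monomial ?\<psi> (Dzb ` A)) = monomial ?\<psi> (Dzb ` A)"
    proof (intro ext)
      fix x :: "'n option cspace" and T
      have "exp (- of_real c * cnj (a + x $ None)) * of_real (exp (c * Re a)) =
          exp (- of_real c * cnj (x $ None)) * (exp (- of_real c * cnj a) * of_real (exp (c * Re a)))"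
        by (simp only: complex_cnj_add distrib_left exp_add mult_ac)
      then have "exp (- of_real c * cnj (a + x $ None)) * of_real (exp (c * Re a)) = ?\<psi> x"
        unfolding resonant_character(2)[OF a res] by simp
      then show "pullback F (monomial ?\<psi> (Dzb ` A)) x T = monomial ?\<psi> (Dzb ` A) x T"
        by (cases "T = Dzb ` A") (simp_all add: F pullback_nak_mult monomial_def prod nak_mult_component)
    qed
  qed
  have None: "Dz None \<in> Dz ` A" "Dzb None \<in> Dzb ` A" by (simp_all add: A_def)
  have bideg: "Dz -` Dz ` A = A" "Dzb -` Dz ` A = {}" "Dz -` Dzb ` A = {}" "Dzb -` Dzb ` A = A"
    by auto
  have "del (monomial ?\<phi> (Dz ` A)) = (\<lambda>x S. 0)" "delbar (monomial ?\<phi> (Dz ` A)) = (\<lambda>x S. 0)"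
    "del (monomial ?\<psi> (Dzb ` A)) = (\<lambda>x S. 0)" "delbar (monomial ?\<psi> (Dzb ` A)) = (\<lambda>x S. 0)"
    unfolding atomize_conj
    by (intro conjI del_monomial_eq_0 delbar_monomial_eq_0; unfold wirtinger_character; use None in fastforce)
  moreover have "smooth_form (monomial ?\<phi> (Dz ` A))" "smooth_form (monomial ?\<psi> (Dzb ` A))"
    by (intro smooth_form_monomial smooth_character)+
  moreover have "has_bidegree (card A) 0 (monomial ?\<phi> (Dz ` A))"
    "has_bidegree 0 (card A) (monomial ?\<psi> (Dzb ` A))"
    by (auto simp: has_bidegree_def monomial_def bideg)
  ultimately show "bc_harmonic (nak_deck P lam \<tau>) h (card A) 0 (monomial ?\<phi> (Dz ` A))"
    "bc_harmonic (nak_deck P lam \<tau>) h 0 (card A) (monomial ?\<psi> (Dzb ` A))"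
    unfolding bc_harmonic_def quotient_form_def
    using inv del_delbar_hodge_star_holomorphic del_delbar_hodge_star_antiholomorphic by blast+
qed

text \<open>
  The determinant of the linear part of a translation by \<open>(a, b)\<close> is \<open>exp ((\<Sum>i. lam i) Re a) = 1\<close>.
\<close>

lemma hermitian_metric_det_nak_mult:
  assumes "hermitian_metric (nak_deck P lam \<tau>) h" "g \<in> nak_lattice P \<tau>" "(\<Sum>i\<in>UNIV. lam i) = 0"
  shows "det (h (nak_mult lam g x)) = det (h x)"
proof -
  let ?r = "stretch lam (g $ None)"
  have hx: "h x = (\<chi> k l. ?r k * h (nak_mult lam g x) $ k $ l * ?r l)"
    unfolding vec_eq_iff vec_lambda_beta by (intro allI hermitian_metric_nak_mult[OF assms(1,2)])
  have "det (h x) = (\<Prod>k\<in>UNIV. ?r k)\<^sup>2 * det (h (nak_mult lam g x))"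
    by (subst hx) (rule det_scale)
  also have "(\<Prod>k\<in>UNIV. ?r k) = 1"
    unfolding UNIV_option_conv prod_stretch assms(3) by simp
  finally show ?thesis by simp
qed

text \<open>
  Each of \<open>dz\<^sub>K\<close> and \<open>d\<zbar>\<^sub>K\<close> is stretched by \<open>exp (c Re a)\<close>, and each enters the Gram determinant twice.
\<close>

lemma covector_minor_nak_mult:
  fixes lam :: "'n::{finite,linorder} \<Rightarrow> real" and K :: "'n set"
  assumes "hermitian_metric (nak_deck P lam \<tau>) h" "g \<in> nak_lattice P \<tau>"
  defines "A \<equiv> insert None (Some ` K)"
  shows "minor (covector_inner (h (nak_mult lam g x))) (Dz ` A \<union> Dzb ` A) (Dz ` A \<union> Dzb ` A) =
    of_real (exp (4 * (\<Sum>i\<in>K. lam i) * Re (g $ None))) *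
    minor (covector_inner (h x)) (Dz ` A \<union> Dzb ` A) (Dz ` A \<union> Dzb ` A)"
proof -
  let ?r = "stretch lam (g $ None)" and ?S = "Dz ` A \<union> Dzb ` A"
  have "covector_inner (h (nak_mult lam g x)) =
      (\<lambda>s t. ?r (gen_index s) * covector_inner (h x) s t * ?r (gen_index t))"
    by (intro ext covector_inner_scale hermitian_metric_nak_mult[OF assms(1,2)] stretch_nonzero
        posdef_hermitian_det_nonzero hermitian_metric_posdef[OF assms(1)])
  then have "minor (covector_inner (h (nak_mult lam g x))) ?S ?S =
      (\<Prod>s\<in>?S. ?r (gen_index s))\<^sup>2 * minor (covector_inner (h x)) ?S ?S"
    by (simp only: minor_scale)
  also have "(\<Prod>s\<in>?S. ?r (gen_index s)) = (\<Prod>k\<in>A. ?r k)\<^sup>2"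
    by (subst prod.union_disjoint) (auto simp: prod_gen_index power2_eq_square)
  also have "((\<Prod>k\<in>A. ?r k)\<^sup>2)\<^sup>2 = of_real (exp (4 * (\<Sum>i\<in>K. lam i) * Re (g $ None)))"
    unfolding A_def prod_stretch
    by (simp add: mult.assoc flip: exp_of_nat_mult power_mult of_real_power)
  finally show ?thesis .
qed

section \<open>Nonexistence of geometrically-Bott-Chern-formal metrics\<close>

theorem theorem4p2:
  fixes M :: "int ^ 'n::{finite,linorder} ^ 'n::{finite,linorder}"
    and P :: "real ^ 'n::{finite,linorder} ^ 'n::{finite,linorder}"
    and lam :: "'n \<Rightarrow> real" and \<tau> :: real and I J :: "'n set"
  assumes nakamura: "nakamura_data M P lam \<tau>"
    and not_torus: "\<exists>i. lam i \<noteq> 0"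
    and disjoint: "I \<inter> J = {}"
    and resonance: "\<tau> * c_sum lam I J \<in> range (\<lambda>k::int. 2 * pi * real_of_int k) - {0}"
  shows "\<not> (\<exists>h. hermitian_metric (nak_deck P lam \<tau>) h \<and> geom_bc_formal (nak_deck P lam \<tau>) h)"
proof
  let ?D = "nak_deck P lam \<tau>"
  assume "\<exists>h. hermitian_metric ?D h \<and> geom_bc_formal ?D h"
  then obtain h where h: "hermitian_metric ?D h" and formal: "geom_bc_formal ?D h" by blast
  have P: "invertible P" and \<tau>: "\<tau> \<noteq> 0" using nakamura by (simp_all add: nakamura_data_def)
  define K where "K = I \<union> J"
  define c where "c = (\<Sum>i\<in>K. lam i)"
  have "c_sum lam I J = c"
    unfolding c_sum_def c_def K_def using disjoint by (simp add: sum.union_disjoint)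
  then obtain m :: int where res: "\<tau> * c = 2 * pi * of_int m" and c: "c \<noteq> 0"
    using resonance by auto
  define A where "A = insert None (Some ` K)"
  define S where "S = Dz ` A \<union> Dzb ` A"
  define e where "e = (\<lambda>x :: 'n option cspace. exp (- 2 * c * Re (x $ None)))"
  let ?\<phi> = "\<lambda>x :: 'n option cspace. exp (- of_real c * x $ None)"
  let ?\<psi> = "\<lambda>x :: 'n option cspace. exp (- of_real c * cnj (x $ None))"
  let ?\<alpha> = "monomial ?\<phi> (Dz ` A)" and ?\<beta> = "monomial ?\<psi> (Dzb ` A)"
  let ?p = "card A"
  have p: "?p \<le> CARD('n option)" by (intro card_mono) auto
  note char = bc_harmonic_character[OF res[unfolded c_def], folded c_def, folded A_def]
  have "?\<alpha> \<in> bc_harmonic_space ?D h"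
    by (rule bc_harmonic_in_space[OF char(1) p le0])
  moreover have "?\<beta> \<in> bc_harmonic_space ?D h"
    by (rule bc_harmonic_in_space[OF char(2) le0 p])
  ultimately have wedge: "wedge ?\<alpha> ?\<beta> \<in> bc_harmonic_space ?D h"
    using formal unfolding geom_bc_formal_def by blast
  define \<epsilon> where "\<epsilon> = shuffle_sign (Dz ` A) (Dzb ` A)"
  define \<eta> where "\<eta> = monomial (\<lambda>x. \<epsilon> * of_real (e x)) S"
  have \<phi>\<psi>: "?\<phi> x * ?\<psi> x = of_real (e x)" for x
  proof -
    have "?\<phi> x * ?\<psi> x = exp (of_real (- 2 * c * Re (x $ None)))"
      unfolding exp_add[symmetric] by (rule arg_cong[of _ _ exp]) (simp add: complex_eq_iff)
    then show ?thesis by (simp only: e_def exp_of_real)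
  qed
  have \<eta>: "wedge ?\<alpha> ?\<beta> = \<eta>"
    unfolding \<eta>_def S_def \<epsilon>_def by (subst wedge_monomial) (auto simp only: mult.assoc \<phi>\<psi>)
  have "has_bidegree ?p ?p \<eta>"
  proof -
    have "Dz -` S = A" "Dzb -` S = A" by (auto simp: S_def)
    then show ?thesis by (auto simp: has_bidegree_def \<eta>_def monomial_def)
  qed
  then have harmonic: "bc_harmonic ?D h ?p ?p \<eta>"
    using wedge p unfolding \<eta> by (intro bc_harmonic_of_space)
  define \<omega> where "\<omega> = hodge_star h \<eta>"
  have \<omega>: "\<omega> x T = shuffle_sign (- T) T * vol_coeff (h x) * cnj (\<epsilon> * of_real (e x)) *
      minor (covector_inner (h x)) (- T) S" for x T
    unfolding \<omega>_def \<eta>_def by (rule hodge_star_monomial)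
  \<comment> \<open>the coefficient of \<open>\<omega>\<close> at the complement of \<open>S\<close> is \<open>\<kappa> g\<close>\<close>
  define g where "g = (\<lambda>x. Re (det (h x)) * e x * Re (minor (covector_inner (h x)) S S))"
  define \<kappa> where "\<kappa> = shuffle_sign S (- S) * \<epsilon> * ((\<i> / 2) ^ CARD('n option) *
      (- 1) ^ (CARD('n option) * (CARD('n option) - 1) div 2))"
  note pd = hermitian_metric_posdef[OF h]
  show False
  proof (rule no_multiplicative_pluriharmonic_coefficient[OF P \<tau>])
    show "smooth_form \<omega>"
      unfolding \<omega>_def
      using harmonic hermitian_metric_smooth[OF h] posdef_hermitian_det_nonzero[OF pd]
      by (intro smooth_form_hodge_star) (auto simp: bc_harmonic_def quotient_form_def)
    show "del (delbar \<omega>) = (\<lambda>x U. 0)"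
      using harmonic by (simp add: \<omega>_def bc_harmonic_def)
    show "\<omega> (x + v) T = \<omega> x T" if v: "v \<in> nak_lattice P \<tau>" "Re (v $ None) = 0" for v x T
    proof -
      have "h (x + v) = h x"
        using hermitian_metric_nak_mult[OF h v(1), of x] v(2)
        by (simp add: nak_mult_translation vec_eq_iff stretch_def split: option.splits)
      then show ?thesis by (simp add: \<omega> e_def v(2))
    qed
    show "Dz None \<notin> - S" "Dzb None \<notin> - S" by (simp_all add: S_def A_def)
    show "\<omega> x (- S) = \<kappa> * of_real (g x)" for x
    proof -
      have "det (h x) = of_real (Re (det (h x)))"
        and "minor (covector_inner (h x)) S S = of_real (Re (minor (covector_inner (h x)) S S))"
        using posdef_hermitian_det_pos(1)[OF pd] covector_minor_pos(1)[OF pd]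
        by (simp_all add: complex_eq_iff)
      then show ?thesis
        unfolding \<omega> vol_coeff_def by (simp add: \<kappa>_def g_def \<epsilon>_def mult_ac)
    qed
    show "\<kappa> \<noteq> 0" by (simp add: \<kappa>_def \<epsilon>_def shuffle_sign_nonzero)
    show "0 < g x" for x
      using posdef_hermitian_det_pos(2)[OF pd] covector_minor_pos(2)[OF pd]
      by (simp add: g_def e_def)
    show "g (nak_mult lam (point (of_int k) 0) x) = exp (2 * c * of_int k) * g x" for k x
    proof -
      let ?t = "point (of_int k) 0 :: complex ^ 'n option"
      have t: "?t \<in> nak_lattice P \<tau>" by (intro nak_lattice_I lattice1_int lattice2_zero)
      have "e (nak_mult lam ?t x) = exp (- 2 * c * of_int k) * e x"
        by (simp add: e_def nak_mult_component distrib_left flip: exp_add)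
      moreover have "exp (- 2 * c * of_int k) * exp (4 * c * of_int k) = exp (2 * c * of_int k)"
        by (simp flip: exp_add)
      ultimately show ?thesis
        using hermitian_metric_det_nak_mult[OF h t nakamura_sum_lam_eq_0[OF nakamura], of x]
          covector_minor_nak_mult[OF h t, of x K]
        by (simp add: g_def flip: S_def A_def c_def)
    qed
    show "2 * c \<noteq> 0" using c by simp
  qed
qed

end
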